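(* Let $\nu$ be a finite positive Borel measure on $[0,1]$, let $c_\nu\in[1,2]$ be its critical index and $c_\nu'$ the dual exponent of $c_\nu$. Then: (a) If $1\le c_\nu<2$, then $T_\nu:L^1(\mathbb D)\to L^{c_\nu,\infty}(\mathbb D)$ is bounded if and only if $\nu$ satisfies the $2/c_\nu'$-Carleson condition. (b) If $c_\nu=2$, then $T_\nu:L^1(\mathbb D)\to L^{2,\infty}(\mathbb D)$ is bounded if and only if $\nu$ is integrable with respect to the hyperbolic arc length on $[0,1)$.
   Context: $\mathbb D$ is the open unit disk in $\mathbb C$, $dA$ is the Lebesgue area measure normalized so that $A(\mathbb D)=1$, $|E|$ denotes the normalized area of $E$, and $L^p(\mathbb D)=L^p(\mathbb D,dA)$. For a finite positive Borel measure $\nu$ on $[0,1]$, $$T_\nu f(z)=\int_{\mathbb D}\frac{1}{1-z\overline\lambda}\left(\int_0^1\frac{d\nu(r)}{1-rz\overline\lambda}\right)f(\lambda)\,dA(\lambda),\quad z\in\mathbb D.$$ The critical index is $$c_\nu=\sup\left\{1\le c<2:\ \int_0^1\frac{1}{(1-r^2)^{2/c'}}\,d\nu(r)<\infty\right\},$$ where $c'$ denotes the dual exponent, $1/c+1/c'=1$ (with $1'=\infty$, $1/\infty=0$). For $1\le p<\infty$, $L^{p,\infty}(\mathbb D)$ is the space of measurable $f$ with finite quasi-norm $\|f\|_{L^{p,\infty}(\mathbb D)}=\inf\{C>0:\ |\{z\in\mathbb D:|f(z)|>t\}|\le C^p/t^p\ \text{for all } t>0\}$. For $\alpha\ge0$,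 $\nu$ satisfies the $\alpha$-Carleson condition if $\sup_{0<t\le1}\nu([1-t,1))/t^\alpha<\infty$ (for $\alpha=0$ this just says that $\nu$ is finite). $\nu$ is integrable with respect to the hyperbolic arc length on $[0,1)$ if $\int_{[0,1)}\frac{1}{1-r^2}\,d\nu(r)<\infty$. *)

theory Defs
  imports "HOL-Analysis.Analysis"
begin

definition disk_area :: "complex measure" where
  "disk_area = density (lebesgue_on (ball 0 1)) (\<lambda>_. ennreal (1 / pi))"

lemma space_disk_area [simp]: "space disk_area = ball 0 1"
  by (simp add: disk_area_def)

lemma emeasure_disk_area_disk: "emeasure disk_area (ball 0 1) = 1"
proof -
  have "emeasure lborel (ball 0 1 :: complex set) = ennreal pi"
    using emeasure_ball[of 1 "0 :: complex"] by (simp add: unit_ball_vol_2)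
  then have "emeasure (lebesgue_on (ball 0 1 :: complex set)) (ball 0 1) = ennreal pi"
    by (subst emeasure_restrict_space) auto
  then show ?thesis
    by (simp add: disk_area_def emeasure_density_const ennreal_mult[symmetric])
qed

definition T_op :: "real measure \<Rightarrow> (complex \<Rightarrow> complex) \<Rightarrow> complex \<Rightarrow> complex" where
  "T_op \<nu> f z =
     (\<integral>w. 1 / (1 - z * cnj w) * (\<integral>r. 1 / (1 - of_real r * z * cnj w) \<partial>\<nu>) * f w \<partial>disk_area)"

definition dual_exponent :: "real \<Rightarrow> ereal" where
  "dual_exponent c = (if c = 1 then \<infinity> else ereal (c / (c - 1)))"

definition two_over_dual :: "real \<Rightarrow> real" where
  "two_over_dual c = real_of_ereal (2 / dual_exponent c)"

lemma dual_exponent_conjugate: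
  assumes "1 \<le> c"
  shows "1 / ereal c + 1 / dual_exponent c = 1"
  using assms by (auto simp: dual_exponent_def field_simps one_ereal_def)

lemma two_over_dual_eq:
  assumes "1 \<le> c"
  shows "two_over_dual c = 2 * (1 - 1 / c)"
  using assms by (auto simp: two_over_dual_def dual_exponent_def field_simps)

(* 1 / (1 - r^2)^s as an extended nonnegative real, for s >= 0. The case s = 0 is separate
   because 0 powr 0 = 0; the value at r = 1 is 1 for s = 0 and infinity for s > 0, which
   matters when the measure has an atom at 1. *)
definition hyp_weight :: "real \<Rightarrow> real \<Rightarrow> ennreal" where
  "hyp_weight s r = (if s = 0 then 1 else 1 / ennreal ((1 - r\<^sup>2) powr s))"

lemma hyp_weight_at_1: "hyp_weight 0 1 = 1" "s \<noteq> 0 \<Longrightarrow> hyp_weight s 1 = \<infinity>"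
  by (simp_all add: hyp_weight_def)

definition critical_index :: "real measure \<Rightarrow> real" where
  "critical_index \<nu> =
     Sup {c. 1 \<le> c \<and> c < 2 \<and> (\<integral>\<^sup>+ r. hyp_weight (two_over_dual c) r \<partial>\<nu>) < \<infinity>}"

lemma critical_index_bounds:
  assumes "finite_measure \<nu>"
  shows "1 \<le> critical_index \<nu>" "critical_index \<nu> \<le> 2"
proof -
  let ?S = "{c. 1 \<le> c \<and> c < 2 \<and> (\<integral>\<^sup>+ r. hyp_weight (two_over_dual c) r \<partial>\<nu>) < \<infinity>}"
  have "(\<integral>\<^sup>+ r. hyp_weight (two_over_dual 1) r \<partial>\<nu>) = emeasure \<nu> (space \<nu>)"
    by (simp add: two_over_dual_eq hyp_weight_def)
  then have 1: "1 \<in> ?S"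
    using finite_measure.emeasure_finite[OF assms, of "space \<nu>"]
    by (intro CollectI conjI) (auto simp: less_top)
  have "bdd_above ?S" by (rule bdd_aboveI[of _ 2]) auto
  with 1 show "1 \<le> critical_index \<nu>" unfolding critical_index_def by (rule cSup_upper)
  show "critical_index \<nu> \<le> 2"
    unfolding critical_index_def
    by (rule cSup_least) (use 1 in blast, simp)
qed

(* The infimum over the empty set is infinity. *)
definition weak_norm :: "real \<Rightarrow> (complex \<Rightarrow> complex) \<Rightarrow> ennreal" where
  "weak_norm p f = Inf {ennreal C | C. C > 0 \<and>
     (\<forall>t>0. measure disk_area {z \<in> ball 0 1. cmod (f z) > t} \<le> C powr p / t powr p)}"

definition weak_Lp :: "real \<Rightarrow> (complex \<Rightarrow> complex) set" where
  "weak_Lp p = {f \<in> borel_measurable disk_area. weak_norm p f < \<infinity>}"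

definition bounded_L1_weak_Lp :: "real \<Rightarrow> ((complex \<Rightarrow> complex) \<Rightarrow> complex \<Rightarrow> complex) \<Rightarrow> bool" where
  "bounded_L1_weak_Lp p T \<longleftrightarrow>
     (\<exists>K\<ge>0. \<forall>f. integrable disk_area f \<longrightarrow>
        T f \<in> weak_Lp p \<and> weak_norm p (T f) \<le> ennreal (K * (\<integral>z. cmod (f z) \<partial>disk_area)))"

definition Carleson_condition :: "real \<Rightarrow> real measure \<Rightarrow> bool" where
  "Carleson_condition \<alpha> \<nu> \<longleftrightarrow>
     (SUP t\<in>{0<..1}. emeasure \<nu> {1 - t..<1} / ennreal (t powr \<alpha>)) < \<infinity>"

definition hyperbolic_integrable :: "real measure \<Rightarrow> bool" where
  "hyperbolic_integrable \<nu> \<longleftrightarrow>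
     (\<integral>\<^sup>+ r\<in>{0..<1}. ennreal (1 / (1 - r\<^sup>2)) \<partial>\<nu>) < \<infinity>"

end

theory Submission
  imports Defs
begin

text \<open>
The kernel of \<open>T_op \<nu>\<close> at \<open>(z, w)\<close> is \<open>T_kernel \<nu> \<zeta>\<close> with \<open>\<zeta> = z * cnj w\<close>, where
\<open>T_kernel \<nu> \<zeta> = 1 / (1 - \<zeta>) * \<integral>r. 1 / (1 - r * \<zeta>) \<partial>\<nu>\<close>. The weak-type estimate
into weak \<open>L\<^sup>c\<close> follows as soon as the kernel is bounded by a multiple of \<open>cmod (1 - \<zeta>) powr (- 2 / c)\<close>,
and conversely the estimate controls the size of the kernel near the point \<open>1\<close>.

Sufficiency. Since \<open>cmod (1 - r * \<zeta>)\<close> dominates both \<open>1 - r\<close> and \<open>cmod (1 - \<zeta>) / 2\<close>, the kernel bound holds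
for \<open>c = 1\<close> and every finite \<open>\<nu>\<close>; for \<open>1 < c < 2\<close> it follows from the Carleson condition by a
dyadic decomposition of \<open>[0,1)\<close>, and for \<open>c = 2\<close> from hyperbolic integrability. For \<open>c > 1\<close> an
atom of \<open>\<nu>\<close> at \<open>1\<close> is excluded by the definition of the critical index (\<open>no_atom_at_1\<close>).
It remains to see that integration against \<open>cmod (1 - z * cnj w) powr (- 2 / c)\<close> maps \<open>L\<^sup>1\<close> into weak \<open>L\<^sup>c\<close>.
The case \<open>c > 1\<close> reduces to \<open>c = 1\<close> by cutting the kernel at a suitable level
(\<open>weak_type_kernel_power\<close>).

The case \<open>c = 1\<close> is the weak type (1,1) of the positive Bergman operator
(\<open>weak_type_inverse_square\<close>). The kernel \<open>1 / (cmod (1 - z * cnj w))\<^sup>2\<close> is dominated, up to a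
constant, by the sum, over the cells of two shifted dyadic grids in polar coordinates that contain both points, of the reciprocal
areas; so the operator is dominated by the sum of the averages over all cells containing \<open>z\<close>.
The cells of the next generation inside a cell cover at most half of it, and this makes
the distributional estimate \<open>2 * m * x / (t + x)\<close>, with \<open>m\<close> the size of a cell and \<open>x\<close> the average over
it, stable under passing to the parent cell (\<open>nested_cells_weak_type\<close>). This Bellman function
argument takes the place of a Calderon-Zygmund decomposition together with an \<open>L\<^sup>2\<close> bound.

Necessity. The operator is tested on the indicator function of the part in the unit disk of
the disk of radius \<open>t / 8\<close> around \<open>1\<close>.
On the disk of radius \<open>t / 8\<close> around \<open>1 - t\<close> the real part of the kernel is at least a constant
times \<open>1 / t * \<integral>r. 1 / ((1 - r) + t) \<partial>\<nu>\<close>; the weak-type bound then gives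
\<open>\<integral>r. 1 / ((1 - r) + t) \<partial>\<nu> \<le> C * t powr (1 - 2 / c)\<close> (\<open>boundary_potential_le_of_bounded\<close>). For \<open>c < 2\<close>
this contains the Carleson condition, and for \<open>c = 2\<close> Fatou's lemma as \<open>t \<rightarrow> 0\<close> gives hyperbolic
integrability.
\<close>

section \<open>Normalized area on the disk\<close>

lemma finite_measure_disk_area: "finite_measure disk_area"
  by (rule finite_measureI) (simp add: emeasure_disk_area_disk)

lemma sets_disk_area: "sets disk_area = sets (lebesgue_on (ball 0 1))"
  by (simp add: disk_area_def)

lemma measurable_disk_area_borel:
  "f \<in> borel_measurable borel \<Longrightarrow> f \<in> borel_measurable disk_area"
  unfolding disk_area_def
  by (simp add: borel_measurable_if_I measurable_completion measurable_restrict_space1)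

lemma borel_in_sets_disk_area:
  "A \<in> sets borel \<Longrightarrow> A \<subseteq> ball 0 1 \<Longrightarrow> A \<in> sets disk_area"
  unfolding sets_disk_area by (subst sets_restrict_space_iff) auto

lemma measure_disk_area_ball:
  assumes "ball a r \<subseteq> ball 0 1" "0 \<le> r"
  shows "measure disk_area (ball a r) = r\<^sup>2"
proof -
  have "emeasure (lebesgue_on (ball 0 1)) (ball a r) = ennreal (pi * r\<^sup>2)"
    using assms emeasure_ball[of r a] by (subst emeasure_restrict_space) (auto simp: unit_ball_vol_2)
  moreover have "ball a r \<in> sets (lebesgue_on (ball 0 1))"
    using assms(1) borel_in_sets_disk_area sets_disk_area by auto
  ultimately have "emeasure disk_area (ball a r) = ennreal (r\<^sup>2)"
    by (simp add: disk_area_def emeasure_density_const ennreal_mult[symmetric])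
  then show ?thesis by (simp add: measure_def)
qed

text \<open>
The set \<open>A\<close> need not be measurable, because the real-valued measure of a non-measurable set is \<open>0\<close>.
\<close>

lemma measure_disk_area_le_ball:
  assumes "A \<subseteq> cball a r" "0 \<le> r"
  shows "measure disk_area A \<le> r\<^sup>2"
proof (cases "A \<in> sets disk_area")
  case True
  then have AL: "A \<in> sets (lebesgue_on (ball 0 1))" by (simp add: sets_disk_area)
  then have A: "A \<subseteq> ball 0 1" "A \<in> sets lebesgue"
    by (auto simp: sets_restrict_space_iff)
  have "emeasure (lebesgue_on (ball 0 1)) A = emeasure lebesgue A"
    using A by (subst emeasure_restrict_space) auto
  also have "\<dots> \<le> emeasure lebesgue (cball a r)"
    using assms by (intro emeasure_mono) auto
  also have "\<dots> = ennreal (pi * r\<^sup>2)"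
    using assms emeasure_cball[of r a] by (auto simp: unit_ball_vol_2)
  finally have "emeasure disk_area A \<le> ennreal (1/pi) * ennreal (pi * r\<^sup>2)"
    using AL by (simp add: disk_area_def emeasure_density_const mult_left_mono)
  also have "\<dots> = ennreal (r\<^sup>2)" by (simp add: ennreal_mult[symmetric])
  finally show ?thesis by (simp add: measure_def enn2real_leI)
next
  case False
  then show ?thesis by (simp add: measure_notin_sets)
qed

section \<open>A weak-type estimate for nested cells\<close>

text \<open>
The right-hand side is the tangent at \<open>y = 2 * x\<close> of the concave function \<open>y / (s + y)\<close>.
\<close>

lemma quotient_le_tangent:
  fixes s x y :: real
  assumes "s > 0" "x \<ge> 0" "y \<ge> 0"
  shows "y / (s + y) \<le> (4 * x\<^sup>2 + s * y) / (s + 2 * x)\<^sup>2"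
proof -
  have "(4 * x\<^sup>2 + s * y) * (s + y) - y * (s + 2 * x)\<^sup>2 = s * (2 * x - y)\<^sup>2"
    by (simp add: power2_eq_square algebra_simps)
  moreover have "0 \<le> s * (2 * x - y)\<^sup>2" using assms by simp
  ultimately have "y * (s + 2 * x)\<^sup>2 \<le> (4 * x\<^sup>2 + s * y) * (s + y)" by linarith
  moreover have "0 < s + y" "0 < (s + 2 * x)\<^sup>2" using assms by auto
  ultimately show ?thesis
    by (simp add: pos_divide_le_eq pos_le_divide_eq divide_simps)
qed

text \<open>
The cells \<open>Q n k\<close> of generation \<open>n\<close> are the level sets of the label \<open>q n\<close> inside a decreasing sequence
of sets \<open>L n\<close>. The number \<open>m n\<close> bounds the size of the cells of generation \<open>n\<close>, and the children of a
cell have total size at most half of that of the cell. With \<open>x = measure N (Q n k) / m n\<close> the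
asserted bound is \<open>2 * m n * x / (t + x)\<close>.

Induction on the depth \<open>d\<close>: if \<open>t \<le> x\<close> the bound is at least \<open>m n\<close>. Otherwise the averages over the
later cells must sum to more than \<open>s = t - x\<close>, so the point lies in a child. If the children
have sizes \<open>m'\<close> and averages \<open>y\<^sub>i\<close>, the induction hypothesis and concavity bound the sum of the
\<open>2 * m' * y\<^sub>i / (s + y\<^sub>i)\<close> by the case in which half of the cell has average \<open>2 * x\<close>, which is
\<open>2 * m n * x / (s + 2 * x) = 2 * m n * x / (t + x)\<close>.
\<close>

lemma nested_cells_weak_type:
  fixes M N :: "'a measure" and q :: "nat \<Rightarrow> 'a \<Rightarrow> int" and L :: "nat \<Rightarrow> 'a set" and m :: "nat \<Rightarrow> real"
  defines "Q \<equiv> \<lambda>n k. {z \<in> L n. q n z = k}"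
  defines "avg \<equiv> \<lambda>n z. if z \<in> L n then measure N (Q n (q n z)) / m n else 0"
  assumes M: "finite_measure M" and N: "finite_measure N" and sets_N: "sets N = sets M"
    and q [measurable]: "\<And>n. q n \<in> measurable M (count_space UNIV)"
    and L [measurable]: "\<And>n. L n \<in> sets M"
    and dec: "\<And>n. L (Suc n) \<subseteq> L n"
    and nest: "\<And>n z w. q (Suc n) z = q (Suc n) w \<Longrightarrow> q n z = q n w"
    and few: "\<And>n k. finite (q (Suc n) ` {z. q n z = k})"
             "\<And>n k. 2 * real (card (q (Suc n) ` {z. q n z = k})) * m (Suc n) \<le> m n"
    and m: "\<And>n. 0 < m n" "\<And>n k. measure M (Q n k) \<le> m n"
    and t: "0 < t"
  shows "measure M {z \<in> Q n k. t < (\<Sum>i=n..n+d. avg i z)}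
    \<le> 2 * m n * measure N (Q n k) / (m n * t + measure N (Q n k))"
  using t
proof (induction d arbitrary: n k t)
  interpret M: finite_measure M by (rule M)
  interpret N: finite_measure N by (rule N)
  have Q [measurable]: "Q n k \<in> sets M" for n k
  proof -
    have "{z \<in> L n. q n z = k} = L n \<inter> (q n -` {k} \<inter> space M)"
      using sets.sets_into_space[OF L] by auto
    then show ?thesis unfolding Q_def by simp
  qed
  have avg_meas [measurable]: "avg n \<in> borel_measurable M" for n
  proof -
    have "(\<lambda>z. measure N (Q n (q n z)) / m n) \<in> borel_measurable M"
      by (rule measurable_compose[OF q]) simp
    then show ?thesis unfolding avg_def by measurable
  qed
  have level_meas: "{z \<in> Q n k. s < (\<Sum>i=a..b. avg i z)} \<in> sets M" for n k s a b
  proof -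
    have "{z \<in> Q n k. s < (\<Sum>i=a..b. avg i z)} = Q n k \<inter> {z \<in> space M. s < (\<Sum>i=a..b. avg i z)}"
      using sets.sets_into_space[OF Q] by auto
    then show ?thesis by simp
  qed
  have large: "measure M {z \<in> Q n k. P z} \<le> 2 * m n * measure N (Q n k) / (m n * t + measure N (Q n k))"
    if "t \<le> measure N (Q n k) / m n" "0 < t" for n k P and t :: real
  proof -
    have "m n * t \<le> measure N (Q n k)" using that m(1)[of n] by (simp add: field_simps)
    moreover have "0 < m n * t" using that m(1)[of n] by simp
    ultimately have "m n \<le> 2 * m n * measure N (Q n k) / (m n * t + measure N (Q n k))"
      using m(1)[of n] by (simp add: pos_le_divide_eq algebra_simps)
    moreover have "measure M {z \<in> Q n k. P z} \<le> measure M (Q n k)"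
      by (rule M.finite_measure_mono) auto
    ultimately show ?thesis using m(2)[of n k] by linarith
  qed
  {
    case (0 n k t)
    show ?case
    proof (cases "t \<le> measure N (Q n k) / m n")
      case False
      then have "{z \<in> Q n k. t < (\<Sum>i=n..n+0. avg i z)} = {}" by (auto simp: avg_def Q_def)
      then show ?thesis using m(1)[of n] 0 by (simp only: measure_empty) simp
    qed (rule large, use 0 in auto)
  next
    case (Suc d n k t)
    define x where "x = measure N (Q n k) / m n"
    show ?case
    proof (cases "t \<le> x")
      case True
      then show ?thesis unfolding x_def by (rule large) (use Suc in auto)
    next
      case False
      define s where "s = t - x"
      have s: "0 < s" using False by (simp add: s_def)
      have x0: "0 \<le> x" using m(1)[of n] by (simp add: x_def)
      define Ch where "Ch = q (Suc n) ` {z. q n z = k}"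
      define F where "F = (\<lambda>j. measure N (Q (Suc n) j))"
      define m' where "m' = m (Suc n)"
      have m': "0 < m'" by (simp add: m'_def m)
      have sub: "{z \<in> Q n k. t < (\<Sum>i=n..n+Suc d. avg i z)}
        \<subseteq> (\<Union>j\<in>Ch. {z \<in> Q (Suc n) j. s < (\<Sum>i=Suc n..Suc n+d. avg i z)})"
      proof
        fix z assume z: "z \<in> {z \<in> Q n k. t < (\<Sum>i=n..n+Suc d. avg i z)}"
        have "(\<Sum>i=n..n+Suc d. avg i z) = avg n z + (\<Sum>i=Suc n..Suc n+d. avg i z)"
          by (subst sum.atLeast_Suc_atMost) auto
        moreover have "avg n z = x" using z by (auto simp: avg_def Q_def x_def)
        ultimately have gt: "s < (\<Sum>i=Suc n..Suc n+d. avg i z)" using z by (simp add: s_def)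
        have "z \<in> L (Suc n)"
        proof (rule ccontr)
          assume "z \<notin> L (Suc n)"
          have "z \<notin> L i" if "Suc n \<le> i" for i
            using \<open>z \<notin> L (Suc n)\<close> lift_Suc_antimono_le[of L, OF dec that] by blast
          then have "(\<Sum>i=Suc n..Suc n+d. avg i z) = 0" by (intro sum.neutral) (auto simp: avg_def)
          with gt s show False by simp
        qed
        then show "z \<in> (\<Union>j\<in>Ch. {z \<in> Q (Suc n) j. s < (\<Sum>i=Suc n..Suc n+d. avg i z)})"
          using gt z unfolding Ch_def Q_def by auto
      qed
      have finCh: "finite Ch" by (simp add: Ch_def few)
      have "measure M {z \<in> Q n k. t < (\<Sum>i=n..n+Suc d. avg i z)}
        \<le> measure M (\<Union>j\<in>Ch. {z \<in> Q (Suc n) j. s < (\<Sum>i=Suc n..Suc n+d. avg i z)})"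
        by (intro M.finite_measure_mono sub sets.finite_UN finCh level_meas)
      also have "\<dots> \<le> (\<Sum>j\<in>Ch. measure M {z \<in> Q (Suc n) j. s < (\<Sum>i=Suc n..Suc n+d. avg i z)})"
        by (intro M.finite_measure_subadditive_finite finCh) (use level_meas in blast)
      also have "\<dots> \<le> (\<Sum>j\<in>Ch. 2 * m' * F j / (m' * s + F j))"
        unfolding m'_def F_def by (intro sum_mono Suc.IH s)
      also have "\<dots> \<le> (\<Sum>j\<in>Ch. 2 * (4 * x\<^sup>2 * m' + s * F j) / (s + 2 * x)\<^sup>2)"
      proof (rule sum_mono)
        fix j
        have F0: "0 \<le> F j" by (simp add: F_def)
        have "m' * s + F j \<noteq> 0" using m' s F0 by (metis add_pos_nonneg mult_pos_pos less_irrefl)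
        moreover have "s + F j / m' \<noteq> 0" using m' s F0
          by (metis add_pos_nonneg divide_nonneg_pos less_irrefl)
        ultimately have "2 * m' * F j / (m' * s + F j) = 2 * m' * ((F j / m') / (s + F j / m'))"
          using m' by (simp add: field_simps)
        also have "\<dots> \<le> 2 * m' * ((4 * x\<^sup>2 + s * (F j / m')) / (s + 2 * x)\<^sup>2)"
          using quotient_le_tangent[OF s x0, of "F j / m'"] m' F0 by (intro mult_left_mono) auto
        also have "\<dots> = 2 * (4 * x\<^sup>2 * m' + s * F j) / (s + 2 * x)\<^sup>2"
          using m' by (simp add: algebra_simps)
        finally show "2 * m' * F j / (m' * s + F j) \<le> 2 * (4 * x\<^sup>2 * m' + s * F j) / (s + 2 * x)\<^sup>2" .
      qed
      also have "\<dots> = 2 * (4 * x\<^sup>2 * (card Ch * m') + s * sum F Ch) / (s + 2 * x)\<^sup>2"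
        by (simp add: sum_divide_distrib[symmetric] sum_distrib_left[symmetric]
            sum_distrib_right[symmetric] sum.distrib algebra_simps)
      also have "\<dots> \<le> 2 * (2 * x\<^sup>2 * m n + s * (x * m n)) / (s + 2 * x)\<^sup>2"
      proof -
        have "4 * x\<^sup>2 * (card Ch * m') = 2 * x\<^sup>2 * (2 * real (card Ch) * m')" by simp
        also have "\<dots> \<le> 2 * x\<^sup>2 * m n"
          unfolding Ch_def m'_def by (intro mult_left_mono few) auto
        finally have 1: "4 * x\<^sup>2 * (card Ch * m') \<le> 2 * x\<^sup>2 * m n" .
        have "sum F Ch = measure N (\<Union>j\<in>Ch. Q (Suc n) j)"
          unfolding F_def
          by (rule N.finite_measure_finite_Union[symmetric])
             (auto simp: finCh sets_N disjoint_family_on_def Q_def Q[unfolded Q_def])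
        also have "\<dots> \<le> measure N (Q n k)"
        proof (rule N.finite_measure_mono)
          show "(\<Union>j\<in>Ch. Q (Suc n) j) \<subseteq> Q n k"
          proof
            fix w assume "w \<in> (\<Union>j\<in>Ch. Q (Suc n) j)"
            then obtain z where "w \<in> L (Suc n)" "q (Suc n) w = q (Suc n) z" "q n z = k"
              by (auto simp: Ch_def Q_def)
            then have "w \<in> L n" "q n w = k" using dec[of n] nest[of n w z] by auto
            then show "w \<in> Q n k" by (simp add: Q_def)
          qed
        qed (simp add: sets_N)
        also have "\<dots> = x * m n" using m(1)[of n] by (simp add: x_def)
        finally have 2: "s * sum F Ch \<le> s * (x * m n)" using s by simp
        have "4 * x\<^sup>2 * (card Ch * m') + s * sum F Ch \<le> 2 * x\<^sup>2 * m n + s * (x * m n)"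
          using 1 2 by (rule add_mono)
        then show ?thesis by (intro divide_right_mono) auto
      qed
      also have "\<dots> = 2 * m n * x / (s + 2 * x)"
        using s x0 by (simp add: divide_simps power2_eq_square) (simp add: algebra_simps)
      also have "\<dots> = 2 * m n * x / (t + x)" by (simp add: s_def)
      also have "\<dots> = 2 * m n * measure N (Q n k) / (m n * t + measure N (Q n k))"
      proof -
        have F: "measure N (Q n k) = m n * x" using m(1)[of n] by (simp add: x_def)
        have "2 * m n * (m n * x) / (m n * t + m n * x) = (m n * (2 * m n * x)) / (m n * (t + x))"
          by (simp only: distrib_left mult_ac)
        also have "\<dots> = 2 * m n * x / (t + x)"
          by (rule mult_divide_mult_cancel_left) (use m(1)[of n] in simp)
        finally show ?thesis unfolding F by (rule sym)
      qed
      finally show ?thesis .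
    qed
  }
qed

section \<open>Shifted dyadic grids in polar coordinates\<close>

lemma borel_measurable_Arg [measurable]: "Arg \<in> borel_measurable borel"
proof -
  have "(\<lambda>z. if z \<in> - \<real>\<^sub>\<le>\<^sub>0 then Arg z else pi) \<in> borel_measurable borel"
    by (intro borel_measurable_continuous_on_if continuous_on_Arg continuous_on_const) auto
  then have "(\<lambda>z. if z = 0 then 0 else if z \<in> - \<real>\<^sub>\<le>\<^sub>0 then Arg z else pi) \<in> borel_measurable borel"
    by measurable
  moreover have "(\<lambda>z. if z = 0 then 0 else if z \<in> - \<real>\<^sub>\<le>\<^sub>0 then Arg z else pi) = Arg"
  proof
    fix z
    have "Arg z = pi" if "z \<noteq> 0" "z \<in> \<real>\<^sub>\<le>\<^sub>0"
      using that by (subst Arg_eq_pi) (auto simp: complex_nonpos_Reals_iff complex_eq_iff)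
    then show "(if z = 0 then 0 else if z \<in> - \<real>\<^sub>\<le>\<^sub>0 then Arg z else pi) = Arg z"
      by (auto simp: Arg_zero)
  qed
  ultimately show ?thesis by simp
qed

text \<open>
The label of the arc of the \<open>n\<close>-th generation that contains \<open>z\<close>: the circle, measured in full turns, is
divided into \<open>4 ^ n\<close> equal arcs, the subdivision being shifted by \<open>j / 3\<close> of an arc. Only \<open>j = 0\<close>
and \<open>j = 1\<close> are used. In base \<open>4\<close> a shift by a third is compatible with refinement, as
\<open>4 / 3 = 1 + 1 / 3\<close>.
\<close>

definition grid_label :: "int \<Rightarrow> nat \<Rightarrow> complex \<Rightarrow> int" where
  "grid_label j n z = \<lfloor>4 ^ n * (Arg z / (2 * pi)) - j / 3\<rfloor> mod 4 ^ n"

lemma measurable_grid_label: "grid_label j n \<in> measurable disk_area (count_space UNIV)"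
proof -
  have "(\<lambda>z. 4 ^ n * (Arg z / (2 * pi)) - j / 3) \<in> borel_measurable disk_area"
    by (rule measurable_disk_area_borel) measurable
  then show ?thesis unfolding grid_label_def by measurable
qed

lemma grid_label_0: "grid_label j 0 z = 0"
  by (simp add: grid_label_def)

lemma grid_label_parent:
  "grid_label j n z = ((grid_label j (Suc n) z - j) div 4) mod 4 ^ n"
proof -
  define x where "x = Arg z / (2 * pi)"
  define v where "v = \<lfloor>4 ^ Suc n * x - j / 3\<rfloor>"
  have "\<lfloor>4 ^ n * x - j / 3\<rfloor> = \<lfloor>(4 ^ Suc n * x - j / 3 - j) / real_of_int 4\<rfloor>"
    by (rule arg_cong[where f=floor]) (simp add: field_simps)
  also have "\<dots> = (v - j) div 4"
  proof -
    have "\<lfloor>4 ^ Suc n * x - j / 3 - j\<rfloor> = v - j" unfolding v_def by linarith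
    then show ?thesis by (subst floor_divide_real_eq_div) (simp, simp only:)
  qed
  finally have 1: "\<lfloor>4 ^ n * x - j / 3\<rfloor> = (v - j) div 4" .
  have "v mod 4 ^ Suc n - j = v - j + 4 * (- (4 ^ n * (v div 4 ^ Suc n)))"
    by (simp add: minus_mult_div_eq_mod[symmetric] algebra_simps)
  then have "(v mod 4 ^ Suc n - j) div 4 = (v - j) div 4 + - (4 ^ n * (v div 4 ^ Suc n))"
    by simp
  then have "((v mod 4 ^ Suc n - j) div 4) mod 4 ^ n = ((v - j) div 4) mod 4 ^ n"
    by (simp add: mod_diff_eq[symmetric])
  with 1 show ?thesis unfolding grid_label_def x_def[symmetric] v_def by simp
qed

lemma grid_label_children:
  "grid_label j (Suc n) ` {z. grid_label j n z = k} \<subseteq> (\<lambda>i. (4 * k + j + i) mod 4 ^ Suc n) ` {0..<4}"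
proof (rule image_subsetI)
  fix z assume "z \<in> {z. grid_label j n z = k}"
  define l where "l = grid_label j (Suc n) z"
  define e where "e = (l - j) div 4"
  define i where "i = (l - j) mod 4"
  have k: "k = e mod 4 ^ n" using \<open>z \<in> _\<close> grid_label_parent[of j n z] by (simp add: e_def l_def)
  have l: "l = 4 * e + j + i" unfolding e_def i_def by (simp add: algebra_simps)
  have "e = k + 4 ^ n * (e div 4 ^ n)" unfolding k by simp
  then have "l = (4 * k + j + i) + 4 ^ Suc n * (e div 4 ^ n)" using l by (simp add: algebra_simps)
  then have "l mod 4 ^ Suc n = (4 * k + j + i) mod 4 ^ Suc n"
    by (metis mod_mult_self2)
  moreover have "l mod 4 ^ Suc n = l" by (simp add: l_def grid_label_def)
  moreover have "i \<in> {0..<4}" by (simp add: i_def)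
  ultimately show "grid_label j (Suc n) z \<in> (\<lambda>i. (4 * k + j + i) mod 4 ^ Suc n) ` {0..<4}"
    unfolding l_def[symmetric] by auto
qed

lemma grid_label_card_children:
  "finite (grid_label j (Suc n) ` {z. grid_label j n z = k})"
  "card (grid_label j (Suc n) ` {z. grid_label j n z = k}) \<le> 4"
proof -
  show "finite (grid_label j (Suc n) ` {z. grid_label j n z = k})"
    by (rule finite_subset[OF grid_label_children]) simp
  have "card (grid_label j (Suc n) ` {z. grid_label j n z = k})
    \<le> card ((\<lambda>i. (4 * k + j + i) mod 4 ^ Suc n) ` {0..<4})"
    by (rule card_mono[OF _ grid_label_children]) simp
  also have "\<dots> \<le> card {0..<4::int}" by (rule card_image_le) simp
  finally show "card (grid_label j (Suc n) ` {z. grid_label j n z = k}) \<le> 4" by simp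
qed

lemma norm_cis_diff_le: "cmod (cis a - cis b) \<le> \<bar>a - b\<bar>"
proof -
  have "cis a - cis b = cis b * (cis (a - b) - 1)"
    by (simp add: algebra_simps cis_mult)
  then have "cmod (cis a - cis b) = cmod (exp (\<i> * of_real (a - b)) - 1)"
    by (simp add: norm_mult cis_conv_exp)
  also have "\<dots> = 2 * \<bar>sin ((a - b) / 2)\<bar>" by (rule dist_exp_i_1)
  also have "\<dots> \<le> 2 * \<bar>(a - b) / 2\<bar>" by (intro mult_left_mono abs_sin_x_le_abs_x) auto
  finally show ?thesis by simp
qed

text \<open>
Points of the disk at distance at most \<open>4\<^sup>-\<^sup>n\<close> from the circle; the whole disk for \<open>n = 0\<close>. The cells of
generation \<open>n\<close> are the parts of this annulus on which \<open>grid_label j n\<close> is constant.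
\<close>

definition annulus :: "nat \<Rightarrow> complex set" where
  "annulus n = {z \<in> ball 0 1. 1 - cmod z \<le> (1/4) ^ n}"

lemma annulus_sets: "annulus n \<in> sets disk_area"
proof (rule borel_in_sets_disk_area)
  have "annulus n = ball 0 1 \<inter> {z. 1 - cmod z \<le> (1/4) ^ n}" by (auto simp: annulus_def)
  also have "\<dots> \<in> sets borel" by (intro sets.Int) (auto intro!: borel_closed closed_Collect_le continuous_intros)
  finally show "annulus n \<in> sets borel" .
qed (auto simp: annulus_def)

lemma cis_minus_turns: "cis (a - 2 * pi * of_int c) = cis a"
proof -
  have "cis (2 * pi * of_int c) = 1" by (rule cis_multiple_2pi) simp
  then show ?thesis by (simp add: cis_divide[symmetric])
qed

lemma grid_cell_diameter:
  assumes "z \<in> annulus n" "w \<in> annulus n" "grid_label j n z = grid_label j n w"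
  shows "dist z w \<le> 9 * (1/4) ^ n"
proof -
  define x where "x = Arg z / (2 * pi)"
  define y where "y = Arg w / (2 * pi)"
  obtain c where c: "\<lfloor>4 ^ n * x - j / 3\<rfloor> = \<lfloor>4 ^ n * y - j / 3\<rfloor> + 4 ^ n * c"
    using assms(3) unfolding grid_label_def x_def[symmetric] y_def[symmetric]
    by (metis mod_eqE)
  have "\<bar>4 ^ n * x - 4 ^ n * y - 4 ^ n * real_of_int c\<bar> < 1"
  proof -
    have "real_of_int \<lfloor>4 ^ n * x - j / 3\<rfloor> = real_of_int \<lfloor>4 ^ n * y - j / 3\<rfloor> + 4 ^ n * real_of_int c"
      by (simp add: c)
    then show ?thesis by linarith
  qed
  moreover have "4 ^ n * x - 4 ^ n * y - 4 ^ n * real_of_int c = 4 ^ n * (x - y - c)"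
    by (simp add: algebra_simps)
  ultimately have "4 ^ n * \<bar>x - y - c\<bar> < 1"
    by (simp add: abs_mult)
  then have xy: "\<bar>x - y - c\<bar> < (1/4) ^ n" by (simp add: field_simps power_divide)
  have "Arg z - 2 * pi * c - Arg w = 2 * pi * (x - y - c)"
    by (simp add: x_def y_def field_simps)
  then have "\<bar>Arg z - 2 * pi * c - Arg w\<bar> = 2 * pi * \<bar>x - y - c\<bar>" by (simp add: abs_mult)
  also have "\<dots> \<le> 8 * (1/4) ^ n" using xy pi_less_4 by (intro mult_mono) auto
  finally have ang: "\<bar>Arg z - 2 * pi * c - Arg w\<bar> \<le> 8 * (1/4) ^ n" .
  have zw: "z = cmod z * cis (Arg z)" "w = cmod w * cis (Arg w)"
    using rcis_cmod_Arg[of z] rcis_cmod_Arg[of w] by (simp_all add: rcis_def)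
  have "z - w = (cmod z - cmod w) * cis (Arg z) + cmod w * (cis (Arg z - 2 * pi * c) - cis (Arg w))"
    unfolding cis_minus_turns by (subst zw(1), subst zw(2)) (simp add: algebra_simps)
  also have "cmod \<dots> \<le> \<bar>cmod z - cmod w\<bar> + cmod w * cmod (cis (Arg z - 2 * pi * c) - cis (Arg w))"
    by (rule norm_triangle_le) (simp add: norm_mult flip: of_real_diff)
  also have "\<dots> \<le> (1/4) ^ n + 1 * (8 * (1/4) ^ n)"
    using assms(1,2) ang norm_cis_diff_le[of "Arg z - 2 * pi * c" "Arg w"]
    by (intro add_mono mult_mono) (auto simp: annulus_def)
  finally show ?thesis by (simp add: dist_norm)
qed

lemma grid_cell_area: "measure disk_area {z \<in> annulus n. grid_label j n z = k} \<le> 81 / 16 ^ n"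
proof (cases "{z \<in> annulus n. grid_label j n z = k} = {}")
  case False
  then obtain w where w: "w \<in> annulus n" "grid_label j n w = k" by auto
  have "{z \<in> annulus n. grid_label j n z = k} \<subseteq> cball w (9 * (1/4) ^ n)"
  proof
    fix x assume "x \<in> {z \<in> annulus n. grid_label j n z = k}"
    then have "dist w x \<le> 9 * (1/4) ^ n"
      using w by (intro grid_cell_diameter[of _ _ _ j]) auto
    then show "x \<in> cball w (9 * (1/4) ^ n)" by simp
  qed
  from measure_disk_area_le_ball[OF this]
  have "measure disk_area {z \<in> annulus n. grid_label j n z = k} \<le> (9 * (1/4) ^ n)\<^sup>2" by simp
  also have "\<dots> = 81 / 16 ^ n" by (simp add: power_mult_distrib power_divide power2_eq_square flip: power_mult_distrib)
  finally show ?thesis .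
qed (simp only: measure_empty, simp)

text \<open>
The endpoints of the grids \<open>\<int>\<close> and \<open>\<int> + 1/3\<close> are at distance at least \<open>1/3\<close> from each other, so
two points that are closer than this cannot be separated by both grids.
\<close>

lemma floor_eq_or_shifted:
  fixes a b :: real
  assumes "\<bar>a - b\<bar> < 1/3"
  shows "\<lfloor>a\<rfloor> = \<lfloor>b\<rfloor> \<or> \<lfloor>a - 1/3\<rfloor> = \<lfloor>b - 1/3\<rfloor>"
proof -
  have *: "\<lfloor>a\<rfloor> = \<lfloor>b\<rfloor> \<or> \<lfloor>a - 1/3\<rfloor> = \<lfloor>b - 1/3\<rfloor>" if "a \<le> b" "b < a + 1/3" for a b :: real
  proof (rule ccontr)
    assume "\<not> ?thesis"
    moreover have "\<lfloor>a\<rfloor> \<le> \<lfloor>b\<rfloor>" "\<lfloor>a - 1/3\<rfloor> \<le> \<lfloor>b - 1/3\<rfloor>" using that by (auto intro!: floor_mono)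
    ultimately have "\<lfloor>a\<rfloor> < \<lfloor>b\<rfloor>" "\<lfloor>a - 1/3\<rfloor> < \<lfloor>b - 1/3\<rfloor>" by auto
    then have "a < \<lfloor>b\<rfloor>" "a - 1/3 < \<lfloor>b - 1/3\<rfloor>" by (simp_all add: floor_less_iff)
    then have "real_of_int \<lfloor>b - 1/3\<rfloor> < \<lfloor>b\<rfloor>" "real_of_int \<lfloor>b\<rfloor> < \<lfloor>b - 1/3\<rfloor> + 1"
      using that by linarith+
    then have "\<lfloor>b - 1/3\<rfloor> < \<lfloor>b\<rfloor>" "\<lfloor>b\<rfloor> < \<lfloor>b - 1/3\<rfloor> + 1" by (simp_all only: of_int_less_iff)
    then show False by linarith
  qed
  show ?thesis using *[of a b] *[of b a] assms by linarith
qed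

lemma one_minus_mult_cnj_ge:
  assumes "cmod z \<le> 1" "cmod w \<le> 1"
  shows "1 - cmod z \<le> cmod (1 - z * cnj w)" "1 - cmod w \<le> cmod (1 - z * cnj w)"
proof -
  have "1 - cmod z * cmod w \<le> cmod (1 - z * cnj w)"
    using norm_triangle_ineq2[of 1 "z * cnj w"] by (simp add: norm_mult)
  moreover have "cmod z * cmod w \<le> cmod z" "cmod z * cmod w \<le> cmod w"
    using assms by (simp_all add: mult_left_le mult_left_le_one_le)
  ultimately show "1 - cmod z \<le> cmod (1 - z * cnj w)" "1 - cmod w \<le> cmod (1 - z * cnj w)" by auto
qed

text \<open>
The difference of the arguments of \<open>z\<close> and \<open>w\<close> is, up to full turns, the argument of
\<open>\<zeta> = z * cnj w\<close>, which is at most \<open>2 * cmod (1 - \<zeta>)\<close> for \<open>\<zeta>\<close> near \<open>1\<close>.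
\<close>

lemma common_grid_label:
  assumes "cmod (1 - z * cnj w) \<le> (1/4) ^ n" "z \<in> ball 0 1" "w \<in> ball 0 1"
  shows "grid_label 0 n z = grid_label 0 n w \<or> grid_label 1 n z = grid_label 1 n w"
proof (cases n)
  case (Suc n')
  define \<zeta> where "\<zeta> = z * cnj w"
  have "(1/4::real) ^ n \<le> 1/4" using Suc by (simp add: power_le_one)
  then have d: "cmod (\<zeta> - 1) \<le> 1/4" using assms(1) by (simp add: \<zeta>_def norm_minus_commute)
  then have nz: "\<zeta> \<noteq> 0" by auto
  then have nz': "z \<noteq> 0" "w \<noteq> 0" by (auto simp: \<zeta>_def)
  have "\<bar>Arg \<zeta>\<bar> \<le> cmod (Ln (1 + (\<zeta> - 1)))"
    using nz abs_Im_le_cmod[of "Ln \<zeta>"] by (simp add: Arg_eq_Im_Ln)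
  also have "\<dots> \<le> 2 * cmod (\<zeta> - 1)" using d by (intro norm_Ln_le) auto
  finally have arg: "\<bar>Arg \<zeta>\<bar> \<le> 2 * (1/4) ^ n" using assms(1) by (simp add: \<zeta>_def norm_minus_commute)
  have "cis (Arg z - Arg w) = cis (Arg \<zeta>)"
  proof -
    have "cis (Arg z - Arg w) = cis (Arg z) * cnj (cis (Arg w))"
      by (simp add: cis_cnj cis_mult)
    also have "\<dots> = sgn z * cnj (sgn w)" using nz' by (simp add: cis_Arg)
    also have "\<dots> = sgn \<zeta>" by (simp add: \<zeta>_def sgn_eq norm_mult)
    finally show ?thesis using nz by (simp add: cis_Arg)
  qed
  then have "sin (Arg z - Arg w) = sin (Arg \<zeta>) \<and> cos (Arg z - Arg w) = cos (Arg \<zeta>)"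
    by (simp add: complex_eq_iff)
  then obtain c :: int where c: "Arg z - Arg w = Arg \<zeta> + 2 * pi * c"
    using sin_cos_eq_iff by metis
  define x where "x = 4 ^ n * (Arg z / (2 * pi))"
  define y where "y = 4 ^ n * (Arg w / (2 * pi))"
  have "x - (y + 4 ^ n * c) = 4 ^ n * (Arg \<zeta> / (2 * pi))"
    using c by (simp add: x_def y_def field_simps)
  then have "\<bar>x - (y + 4 ^ n * c)\<bar> = 4 ^ n * \<bar>Arg \<zeta>\<bar> / (2 * pi)" by (simp add: abs_mult)
  also have "\<dots> \<le> 4 ^ n * (2 * (1/4) ^ n) / (2 * pi)"
    using arg by (intro divide_right_mono mult_left_mono) auto
  also have "\<dots> = 1 / pi" by (simp add: power_divide)
  also have "\<dots> < 1/3" using pi_gt3 by (simp add: field_simps)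
  finally have "\<lfloor>x\<rfloor> = \<lfloor>y + 4 ^ n * c\<rfloor> \<or> \<lfloor>x - 1/3\<rfloor> = \<lfloor>y + 4 ^ n * c - 1/3\<rfloor>"
    by (rule floor_eq_or_shifted)
  moreover have "\<lfloor>y + 4 ^ n * c\<rfloor> = \<lfloor>y\<rfloor> + 4 ^ n * c"
    by (metis floor_add_int of_int_mult of_int_numeral of_int_power)
  moreover have "\<lfloor>y + 4 ^ n * c - 1/3\<rfloor> = \<lfloor>y - 1/3\<rfloor> + 4 ^ n * c"
  proof -
    have "y + 4 ^ n * c - 1/3 = (y - 1/3) + of_int (4 ^ n * c)" by simp
    then show ?thesis by (metis floor_add_int)
  qed
  ultimately show ?thesis
    unfolding grid_label_def x_def[symmetric] y_def[symmetric] by (auto)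
qed (simp add: grid_label_0)

section \<open>Weak type (1,1) of the positive Bergman operator\<close>

text \<open>
The average of the measure \<open>N\<close> over the cell of generation \<open>n\<close> that contains \<open>z\<close>, with the cell's area
replaced by its upper bound \<open>81 / 16 ^ n\<close>; it is \<open>0\<close> if \<open>z\<close> lies in no such cell.
\<close>

definition grid_average :: "complex measure \<Rightarrow> int \<Rightarrow> nat \<Rightarrow> complex \<Rightarrow> real" where
  "grid_average N j n z =
     (if z \<in> annulus n
      then measure N {w \<in> annulus n. grid_label j n w = grid_label j n z} / (81 / 16 ^ n) else 0)"

lemma grid_average_nonneg: "0 \<le> grid_average N j n z"
  by (simp add: grid_average_def)

lemma annulus_Suc: "annulus (Suc n) \<subseteq> annulus n"
proof -
  have "(1/4::real) ^ Suc n \<le> (1/4) ^ n" by (rule power_decreasing) auto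
  then show ?thesis by (auto simp: annulus_def)
qed

lemma annulus_0: "annulus 0 = ball 0 1"
  by (auto simp: annulus_def)

lemma grid_cell_sets: "{w \<in> annulus n. grid_label j n w = k} \<in> sets disk_area"
proof -
  have "{w \<in> annulus n. grid_label j n w = k} = annulus n \<inter> (grid_label j n -` {k} \<inter> space disk_area)"
    by (auto simp: annulus_def)
  also have "\<dots> \<in> sets disk_area"
    by (intro sets.Int annulus_sets measurable_sets[OF measurable_grid_label]) auto
  finally show ?thesis .
qed

lemma measurable_grid_average: "grid_average N j n \<in> borel_measurable disk_area"
proof -
  note [measurable] = measurable_grid_label annulus_sets
  have "(\<lambda>z. measure N {w \<in> annulus n. grid_label j n w = grid_label j n z} / (81 / 16 ^ n))
    \<in> borel_measurable disk_area"
    by (rule measurable_compose[OF measurable_grid_label]) simp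
  then show ?thesis unfolding grid_average_def by measurable
qed

lemma grid_average_partial_sum_weak_type:
  assumes "finite_measure N" "sets N = sets disk_area" "0 < t"
  shows "measure disk_area {z \<in> ball 0 1. t < (\<Sum>i\<le>d. grid_average N j i z)} \<le> 2 * measure N (ball 0 1) / t"
proof -
  have root: "{z \<in> annulus 0. grid_label j 0 z = 0} = ball 0 1" by (auto simp: annulus_0 grid_label_0)
  have "measure disk_area {z \<in> {z \<in> annulus 0. grid_label j 0 z = 0}. t < (\<Sum>i=0..0+d.
      if z \<in> annulus i then measure N {w \<in> annulus i. grid_label j i w = grid_label j i z} / (81 / 16 ^ i) else 0)}
    \<le> 2 * (81 / 16 ^ 0) * measure N {z \<in> annulus 0. grid_label j 0 z = 0}
      / ((81 / 16 ^ 0) * t + measure N {z \<in> annulus 0. grid_label j 0 z = 0})"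
  proof (rule nested_cells_weak_type)
    show "grid_label j n z = grid_label j n w" if "grid_label j (Suc n) z = grid_label j (Suc n) w" for n z w
      using that by (simp add: grid_label_parent[of j n])
    show "2 * real (card (grid_label j (Suc n) ` {z. grid_label j n z = k})) * (81 / 16 ^ Suc n) \<le> 81 / 16 ^ n" for n k
      using grid_label_card_children(2)[of j n k] by (simp add: field_simps)
  qed (use assms finite_measure_disk_area annulus_Suc annulus_sets measurable_grid_label
         grid_label_card_children(1) grid_cell_area in auto)
  also have "\<dots> = 162 * measure N (ball 0 1) / (81 * t + measure N (ball 0 1))"
    unfolding root by simp
  also have "\<dots> \<le> 162 * measure N (ball 0 1) / (81 * t)"
    using assms(3) by (intro divide_left_mono) (auto intro!: mult_pos_pos add_pos_nonneg)
  finally show ?thesis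
    unfolding root by (simp add: grid_average_def atMost_atLeast0)
qed

text \<open>
For \<open>n\<close> with \<open>(1/4) ^ Suc n < cmod (1 - z * cnj w) \<le> (1/4) ^ n\<close> both points lie in a common cell of
generation \<open>n\<close> of one of the two grids. Since \<open>cmod (1 - z * cnj w) \<ge> 1 - cmod z\<close>, only finitely many
generations matter for a given \<open>z\<close>.
\<close>

lemma inverse_square_le_grid_sum:
  assumes z: "z \<in> ball 0 1" and w: "w \<in> ball 0 1" and D: "(1/4) ^ Suc D < 1 - cmod z"
  shows "1 / (cmod (1 - z * cnj w))\<^sup>2 \<le>
    16 * (\<Sum>j\<in>{0,1}. \<Sum>n\<le>D. 16 ^ n * indicator {w. z \<in> annulus n \<and> w \<in> annulus n \<and> grid_label j n w = grid_label j n z} w)"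
    (is "_ \<le> 16 * (\<Sum>j\<in>_. \<Sum>n\<le>D. ?g j n)")
proof -
  define d where "d = cmod (1 - z * cnj w)"
  have d: "1 - cmod z \<le> d" "1 - cmod w \<le> d"
    using one_minus_mult_cnj_ge[of z w] z w by (auto simp: d_def)
  \<comment> \<open>If \<open>d > 1\<close> then \<open>n = 0\<close> and \<open>d \<le> (1/4) ^ n\<close> fails, but the only cell of generation \<open>0\<close>
     is the whole disk.\<close>
  define n where "n = (LEAST n. (1/4) ^ Suc n < d)"
  have n1: "(1/4) ^ Suc n < d" unfolding n_def by (rule LeastI[of _ D]) (use D d in linarith)
  have nD: "n \<le> D" unfolding n_def by (rule Least_le) (use D d in linarith)
  have n2: "n = 0 \<or> d \<le> (1/4) ^ n"
  proof (cases n)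
    case (Suc n')
    then have "\<not> (1/4) ^ Suc n' < d" unfolding n_def using not_less_Least[of n'] by (metis lessI n_def Suc)
    then show ?thesis using Suc by simp
  qed simp
  have "0 < d" using n1 by (rule order.strict_trans[rotated]) simp
  have ann: "z \<in> annulus n" "w \<in> annulus n" using n2 d z w by (auto simp: annulus_def)
  have "\<exists>j\<in>{0,1}. grid_label j n w = grid_label j n z"
    using n2
  proof
    assume "d \<le> (1/4) ^ n"
    from common_grid_label[OF this[unfolded d_def] z w] show ?thesis by auto
  qed (auto simp: grid_label_0)
  then obtain j :: int where j: "j \<in> {0,1}" "grid_label j n w = grid_label j n z" by auto
  have "1 / d\<^sup>2 \<le> 1 / ((1/4) ^ Suc n)\<^sup>2"
    using n1 \<open>0 < d\<close> by (intro divide_left_mono power_mono) auto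
  also have "\<dots> = 16 * 16 ^ n"
    by (simp add: power_divide power2_eq_square flip: power_mult_distrib)
  also have "\<dots> = 16 * ?g j n" using ann j by simp
  also have "?g j n \<le> (\<Sum>n\<le>D. ?g j n)" using nD by (intro member_le_sum) auto
  also have "\<dots> \<le> (\<Sum>j\<in>{0,1}. \<Sum>n\<le>D. ?g j n)"
    using j by (intro member_le_sum[of j _ "\<lambda>j. \<Sum>n\<le>D. ?g j n"]) (auto intro!: sum_nonneg)
  finally show ?thesis unfolding d_def by simp
qed

lemma integral_inverse_square_le_grid_sum:
  assumes N: "finite_measure N" "sets N = sets disk_area"
    and z: "z \<in> ball 0 1" and D: "(1/4) ^ Suc D < 1 - cmod z"
  shows "(\<integral>w. 1 / (cmod (1 - z * cnj w))\<^sup>2 \<partial>N) \<le> 1296 * (\<Sum>j\<in>{0,1}. \<Sum>n\<le>D. grid_average N j n z)"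
proof -
  interpret N: finite_measure N by (rule N)
  have sp: "space N = ball 0 1" using sets_eq_imp_space_eq[OF N(2)] by simp
  define S where "S = (\<lambda>j n. {w. z \<in> annulus n \<and> w \<in> annulus n \<and> grid_label j n w = grid_label j n z})"
  have S_sets: "S j n \<in> sets N" for j n
    using grid_cell_sets[of n j "grid_label j n z"] by (cases "z \<in> annulus n") (auto simp: S_def N)
  have int: "integrable N (indicat_real (S j n))" for j n
    using S_sets N.emeasure_finite by (simp add: less_top[symmetric])
  have val: "16 ^ n * measure N (S j n) = 81 * grid_average N j n z" for j n
    by (simp add: grid_average_def S_def)
  have "(\<integral>w. 1 / (cmod (1 - z * cnj w))\<^sup>2 \<partial>N)
      \<le> (\<integral>w. 16 * (\<Sum>j\<in>{0,1}. \<Sum>n\<le>D. 16 ^ n * indicat_real (S j n) w) \<partial>N)"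
  proof (rule integral_mono')
    show "integrable N (\<lambda>w. 16 * (\<Sum>j\<in>{0,1}. \<Sum>n\<le>D. 16 ^ n * indicat_real (S j n) w))"
      by (intro integrable_mult_right Bochner_Integration.integrable_sum int)
    show "1 / (cmod (1 - z * cnj w))\<^sup>2 \<le> 16 * (\<Sum>j\<in>{0,1}. \<Sum>n\<le>D. 16 ^ n * indicat_real (S j n) w)"
      if "w \<in> space N" for w
      using inverse_square_le_grid_sum[OF z _ D, of w] that unfolding sp S_def by blast
    show "0 \<le> 16 * (\<Sum>j\<in>{0,1}. \<Sum>n\<le>D. 16 ^ n * indicat_real (S j n) w)" for w
      by (intro mult_nonneg_nonneg sum_nonneg) auto
  qed
  also have "\<dots> = 16 * (\<Sum>j\<in>{0,1}. \<Sum>n\<le>D. 16 ^ n * measure N (S j n))"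
  proof -
    have "(\<integral>w. indicat_real (S j n) w \<partial>N) = measure N (S j n)" for j n
      using sets.sets_into_space[OF S_sets] by (simp add: Int_absorb2)
    then show ?thesis
      by (subst Bochner_Integration.integral_mult_right_zero)
         (simp only: Bochner_Integration.integral_sum Bochner_Integration.integrable_sum
            integral_mult_right_zero integrable_mult_right int)
  qed
  also have "\<dots> = 1296 * (\<Sum>j\<in>{0,1}. \<Sum>n\<le>D. grid_average N j n z)"
    unfolding val by (simp add: sum_distrib_left)
  finally show ?thesis .
qed

text \<open>
Weak type (1,1) of the operator with kernel \<open>1 / (cmod (1 - z * cnj w))\<^sup>2\<close>, for finite measures in
place of integrable functions. The bound is stated for all subsets \<open>X\<close> of the level set, measurable or
not.
\<close>

theorem weak_type_inverse_square:
  assumes N: "finite_measure N" "sets N = sets disk_area" and t: "0 < t"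
    and X: "X \<subseteq> {z \<in> ball 0 1. t < (\<integral>w. 1 / (cmod (1 - z * cnj w))\<^sup>2 \<partial>N)}"
  shows "measure disk_area X \<le> 10368 * measure N (ball 0 1) / t"
proof -
  interpret A: finite_measure disk_area by (rule finite_measure_disk_area)
  \<comment> \<open>If the integral exceeds \<open>t\<close>, one of the two grids has a sum of averages above
     \<open>t / (2 * 1296)\<close>.\<close>
  define E where "E = (\<lambda>j d. {z \<in> ball 0 1. t / 2592 < (\<Sum>i\<le>d. grid_average N j i z)})"
  have E_sets: "E j d \<in> sets disk_area" for j d
  proof -
    have "(\<lambda>z. \<Sum>i\<le>d. grid_average N j i z) \<in> borel_measurable disk_area"
      by (intro borel_measurable_sum measurable_grid_average)
    then have "{z \<in> space disk_area. t / 2592 < (\<Sum>i\<le>d. grid_average N j i z)} \<in> sets disk_area" by measurable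
    then show ?thesis unfolding E_def by simp
  qed
  have E_inc: "incseq (E j)" for j
  proof (rule incseq_SucI)
    show "E j d \<le> E j (Suc d)" for d
      using grid_average_nonneg[of N j "Suc d"] by (auto simp: E_def intro: less_le_trans)
  qed
  have E_union: "measure disk_area (\<Union>d. E j d) \<le> 5184 * measure N (ball 0 1) / t" for j
  proof (rule LIMSEQ_le_const2)
    show "(\<lambda>d. measure disk_area (E j d)) \<longlonglongrightarrow> measure disk_area (\<Union>d. E j d)"
      by (rule A.finite_Lim_measure_incseq) (use E_sets E_inc in auto)
    show "\<exists>M. \<forall>d\<ge>M. measure disk_area (E j d) \<le> 5184 * measure N (ball 0 1) / t"
      using grid_average_partial_sum_weak_type[OF N, of "t / 2592"] t by (simp add: E_def)
  qed
  have "X \<subseteq> (\<Union>d. E 0 d) \<union> (\<Union>d. E 1 d)"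
  proof
    fix z assume "z \<in> X"
    with X have z: "z \<in> ball 0 1" "t < (\<integral>w. 1 / (cmod (1 - z * cnj w))\<^sup>2 \<partial>N)" by auto
    then have "0 < 1 - cmod z" by simp
    then obtain D where "(1/4) ^ D < 1 - cmod z" using real_arch_pow_inv[of "1 - cmod z" "1/4"] by auto
    then have D: "(1/4) ^ Suc D < 1 - cmod z"
      using power_decreasing[of D "Suc D" "1/4::real"] by linarith
    have "t < 1296 * ((\<Sum>n\<le>D. grid_average N 0 n z) + (\<Sum>n\<le>D. grid_average N 1 n z))"
      using integral_inverse_square_le_grid_sum[OF N z(1) D] z(2) by simp
    then have "t / 2592 < (\<Sum>n\<le>D. grid_average N 0 n z) \<or> t / 2592 < (\<Sum>n\<le>D. grid_average N 1 n z)"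
      by (auto simp: field_simps)
    then show "z \<in> (\<Union>d. E 0 d) \<union> (\<Union>d. E 1 d)" using z(1) by (auto simp: E_def)
  qed
  then have "measure disk_area X
    \<le> measure disk_area ((\<Union>d. E 0 d) \<union> (\<Union>d. E 1 d))"
    by (rule A.finite_measure_mono) (use E_sets in auto)
  also have "\<dots> \<le> measure disk_area (\<Union>d. E 0 d) + measure disk_area (\<Union>d. E 1 d)"
    by (rule measure_Un_le) (use E_sets in auto)
  also have "\<dots> \<le> 10368 * measure N (ball 0 1) / t"
    using E_union[of 0] E_union[of 1] by (simp add: add_divide_distrib[symmetric])
  finally show ?thesis .
qed

section \<open>From kernel bounds to weak-type bounds\<close>

lemma integrable_kernel_power:
  assumes N: "finite_measure N" "sets N = sets disk_area" and z: "z \<in> ball 0 1" and "0 \<le> \<beta>"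
  shows "integrable N (\<lambda>w. 1 / cmod (1 - z * cnj w) powr \<beta>)"
proof -
  interpret N: finite_measure N by (rule N)
  have sp: "space N = ball 0 1" using sets_eq_imp_space_eq[OF N(2)] by simp
  have "(\<lambda>w. 1 / cmod (1 - z * cnj w) powr \<beta>) \<in> borel_measurable borel"
  proof -
    have "(\<lambda>w. cmod (1 - z * cnj w)) \<in> borel_measurable borel"
      by (intro borel_measurable_continuous_onI continuous_intros)
    then show ?thesis by measurable
  qed
  then have "(\<lambda>w. 1 / cmod (1 - z * cnj w) powr \<beta>) \<in> borel_measurable N"
    using measurable_disk_area_borel measurable_cong_sets[OF N(2) refl] by blast
  moreover have "1 / cmod (1 - z * cnj w) powr \<beta> \<le> 1 / (1 - cmod z) powr \<beta>" if "w \<in> space N" for w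
  proof -
    have "1 - cmod z \<le> cmod (1 - z * cnj w)" using one_minus_mult_cnj_ge(1)[of z w] z that sp by auto
    moreover have "0 < 1 - cmod z" using z by simp
    ultimately show ?thesis using \<open>0 \<le> \<beta>\<close> by (intro divide_left_mono powr_mono2 mult_pos_pos) auto
  qed
  ultimately show ?thesis
    by (intro N.integrable_const_bound[of _ "1 / (1 - cmod z) powr \<beta>"] AE_I2) auto
qed

text \<open>
At the threshold \<open>\<delta>\<close> with \<open>\<delta> powr (- 2 / c) * a = t / 2\<close> the kernel splits into a part that
contributes at most \<open>t / 2\<close> to the integral and a part that is at most
\<open>\<delta> powr (2 - 2 / c)\<close> times the kernel for \<open>c = 1\<close>.
\<close>

lemma weak_type_kernel_power:
  assumes N: "finite_measure N" "sets N = sets disk_area" and t: "0 < t" and c: "1 \<le> c"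
    and a: "measure N (ball 0 1) < a"
    and X: "X \<subseteq> {z \<in> ball 0 1. t < (\<integral>w. 1 / cmod (1 - z * cnj w) powr (2 / c) \<partial>N)}"
  shows "measure disk_area X \<le> 10368 * (2 * a / t) powr c"
proof -
  interpret N: finite_measure N by (rule N)
  have sp: "space N = ball 0 1" using sets_eq_imp_space_eq[OF N(2)] by simp
  define \<beta> where "\<beta> = 2 / c"
  have \<beta>: "0 < \<beta>" "\<beta> \<le> 2" using c by (auto simp: \<beta>_def field_simps)
  have a0: "0 < a" using a measure_nonneg[of N "ball 0 1"] by linarith
  define \<delta> where "\<delta> = (2 * a / t) powr (c / 2)"
  have \<delta>: "0 < \<delta>" using a0 t by (simp add: \<delta>_def)
  have "\<delta> powr \<beta> = 2 * a / t" using a0 t c by (simp add: \<delta>_def powr_powr \<beta>_def)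
  then have \<delta>\<beta>: "1 / \<delta> powr \<beta> = t / (2 * a)" by simp
  have \<delta>2: "\<delta>\<^sup>2 = (2 * a / t) powr c"
  proof -
    have "\<delta>\<^sup>2 = \<delta> powr 2" using \<delta> by simp
    then show ?thesis by (simp add: \<delta>_def powr_powr)
  qed
  have \<delta>2\<beta>: "\<delta> powr (2 - \<beta>) = (2 * a / t) powr c * (t / (2 * a))"
  proof -
    have "\<delta> powr (2 - \<beta>) = \<delta>\<^sup>2 * (1 / \<delta> powr \<beta>)" using \<delta> by (simp add: powr_diff)
    then show ?thesis by (simp only: \<delta>2 \<delta>\<beta>)
  qed
  define P where "P = (\<lambda>z. \<integral>w. 1 / (cmod (1 - z * cnj w))\<^sup>2 \<partial>N)"
  define s where "s = t / 2 / \<delta> powr (2 - \<beta>)"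
  have s: "0 < s" using t \<delta> by (simp add: s_def)
  have "X \<subseteq> {z \<in> ball 0 1. s < P z}"
  proof
    fix z assume "z \<in> X"
    with X have z: "z \<in> ball 0 1" and gt: "t < (\<integral>w. 1 / cmod (1 - z * cnj w) powr \<beta> \<partial>N)"
      by (auto simp: \<beta>_def)
    have int2: "integrable N (\<lambda>w. 1 / (cmod (1 - z * cnj w))\<^sup>2)"
      using integrable_kernel_power[OF N z, of 2] by simp
    have "(\<integral>w. 1 / cmod (1 - z * cnj w) powr \<beta> \<partial>N)
      \<le> (\<integral>w. 1 / \<delta> powr \<beta> + \<delta> powr (2 - \<beta>) * (1 / (cmod (1 - z * cnj w))\<^sup>2) \<partial>N)"
    proof (rule integral_mono')
      show "integrable N (\<lambda>w. 1 / \<delta> powr \<beta> + \<delta> powr (2 - \<beta>) * (1 / (cmod (1 - z * cnj w))\<^sup>2))"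
        using int2 by (intro Bochner_Integration.integrable_add integrable_mult_right) auto
      fix w assume "w \<in> space N"
      define u where "u = cmod (1 - z * cnj w)"
      have "0 < 1 - cmod z" using z by simp
      then have u: "0 < u" using one_minus_mult_cnj_ge(1)[of z w] z \<open>w \<in> space N\<close> by (auto simp: u_def sp)
      show "1 / u powr \<beta> \<le> 1 / \<delta> powr \<beta> + \<delta> powr (2 - \<beta>) * (1 / u\<^sup>2)"
      proof (cases "\<delta> \<le> u")
        case True
        then have "1 / u powr \<beta> \<le> 1 / \<delta> powr \<beta>"
          using \<delta> u \<beta> by (intro divide_left_mono powr_mono2) auto
        moreover have "0 \<le> \<delta> powr (2 - \<beta>) * (1 / u\<^sup>2)" by simp
        ultimately show ?thesis by linarith
      next
        case False
        have "1 / u powr \<beta> = u powr (2 - \<beta>) * (1 / u\<^sup>2)"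
          using u by (simp add: powr_diff)
        also have "\<dots> \<le> \<delta> powr (2 - \<beta>) * (1 / u\<^sup>2)"
          using False u \<beta> by (intro mult_right_mono powr_mono2) auto
        finally show ?thesis using \<delta> by (simp add: add_increasing)
      qed
    qed auto
    also have "\<dots> = measure N (ball 0 1) * (1 / \<delta> powr \<beta>) + \<delta> powr (2 - \<beta>) * P z"
    proof -
      have int2': "integrable N (\<lambda>w. \<delta> powr (2 - \<beta>) * (1 / (cmod (1 - z * cnj w))\<^sup>2))"
        by (rule integrable_mult_right) (rule int2)
      show ?thesis
        unfolding P_def Bochner_Integration.integral_add[OF N.integrable_const int2']
        by (subst integral_mult_right_zero) (simp add: sp)
    qed
    also have "measure N (ball 0 1) * (1 / \<delta> powr \<beta>) \<le> t / 2"
      unfolding \<delta>\<beta> using a a0 t by (simp add: field_simps)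
    finally have "t / 2 < \<delta> powr (2 - \<beta>) * P z" using gt by linarith
    then show "z \<in> {z \<in> ball 0 1. s < P z}"
      using z \<delta> by (simp add: s_def pos_divide_less_eq mult.commute)
  qed
  then have "measure disk_area X \<le> 10368 * measure N (ball 0 1) / s"
    unfolding P_def by (rule weak_type_inverse_square[OF N s])
  also have "\<dots> \<le> 10368 * a / s" using a s by (intro divide_right_mono) auto
  also have "\<dots> = 10368 * (2 * a / t) powr c"
    using a0 t by (simp add: s_def \<delta>2\<beta>)
  finally show ?thesis .
qed

text \<open>
The hypothesis on all \<open>C > C0\<close> also covers \<open>C0 = 0\<close>, which the infimum in \<open>weak_norm\<close> only approaches.
\<close>

lemma weak_norm_le:
  assumes "0 \<le> C0" and "\<And>C t. C0 < C \<Longrightarrow> 0 < t \<Longrightarrow> measure disk_area {z \<in> ball 0 1. cmod (g z) > t} \<le> C powr p / t powr p"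
  shows "weak_norm p g \<le> ennreal C0"
proof (rule ennreal_le_epsilon)
  fix e :: real assume "0 < e"
  then have "weak_norm p g \<le> ennreal (C0 + e)"
    unfolding weak_norm_def using assms by (intro Inf_lower) (auto intro!: exI[of _ "C0 + e"])
  then show "weak_norm p g \<le> ennreal C0 + ennreal e" using \<open>0 \<le> C0\<close> \<open>0 < e\<close> by simp
qed

lemma weak_norm_less_imp:
  assumes "weak_norm p g < ennreal C" "0 < t" "0 \<le> p"
  shows "measure disk_area {z \<in> ball 0 1. cmod (g z) > t} \<le> C powr p / t powr p"
proof -
  obtain C' where C': "0 < C'" "ennreal C' < ennreal C"
    "measure disk_area {z \<in> ball 0 1. cmod (g z) > t} \<le> C' powr p / t powr p"
    using assms(1,2) unfolding weak_norm_def Inf_less_iff by auto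
  then have "C' powr p \<le> C powr p" using assms(3) by (intro powr_mono2) (auto simp: ennreal_less_iff)
  then have "C' powr p / t powr p \<le> C powr p / t powr p" by (intro divide_right_mono) auto
  with C'(3) show ?thesis by linarith
qed

text \<open>
The kernel of \<open>T_op \<nu>\<close> as a function of \<open>\<zeta> = z * cnj w\<close>.
\<close>

definition T_kernel :: "real measure \<Rightarrow> complex \<Rightarrow> complex" where
  "T_kernel \<nu> \<zeta> = 1 / (1 - \<zeta>) * (\<integral>r. 1 / (1 - of_real r * \<zeta>) \<partial>\<nu>)"

lemma T_op_eq: "T_op \<nu> f z = (\<integral>w. T_kernel \<nu> (z * cnj w) * f w \<partial>disk_area)"
  by (simp add: T_op_def T_kernel_def mult.assoc)

lemma measurable_unit_interval_borel:
  assumes "sets \<nu> = sets (restrict_space borel {0..1::real})" "f \<in> borel_measurable borel"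
  shows "f \<in> borel_measurable \<nu>"
  using assms(2) measurable_cong_sets[OF assms(1) refl] measurable_restrict_space1 by blast

lemma measurable_T_kernel:
  assumes "finite_measure \<nu>" "sets \<nu> = sets (restrict_space borel {0..1})"
  shows "T_kernel \<nu> \<in> borel_measurable borel"
proof -
  interpret finite_measure \<nu> by (rule assms)
  have [measurable]: "(\<lambda>r. complex_of_real r) \<in> borel_measurable \<nu>"
    by (rule measurable_unit_interval_borel[OF assms(2)]) measurable
  have "(\<lambda>\<zeta>. \<integral>r. 1 / (1 - complex_of_real r * \<zeta>) \<partial>\<nu>) \<in> borel_measurable borel"
    by (rule borel_measurable_lebesgue_integral) measurable
  then show ?thesis unfolding T_kernel_def by measurable
qed

lemma measurable_T_op:
  assumes "finite_measure \<nu>" "sets \<nu> = sets (restrict_space borel {0..1})"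
    and f [measurable]: "f \<in> borel_measurable disk_area"
  shows "T_op \<nu> f \<in> borel_measurable disk_area"
proof -
  interpret A: finite_measure disk_area by (rule finite_measure_disk_area)
  note [measurable] = measurable_T_kernel[OF assms(1,2)]
  have [measurable]: "(\<lambda>z. z) \<in> borel_measurable disk_area" "cnj \<in> borel_measurable disk_area"
    by (rule measurable_disk_area_borel, intro borel_measurable_continuous_onI continuous_intros)+
  have [measurable]: "(\<lambda>(z, w). z * cnj w) \<in> borel_measurable (disk_area \<Otimes>\<^sub>M disk_area)"
  proof -
    have "(\<lambda>p. fst p) \<in> borel_measurable (disk_area \<Otimes>\<^sub>M disk_area)"
      by (rule measurable_compose[OF measurable_fst]) measurable
    moreover have "(\<lambda>p. cnj (snd p)) \<in> borel_measurable (disk_area \<Otimes>\<^sub>M disk_area)"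
      by (rule measurable_compose[OF measurable_snd]) measurable
    ultimately show ?thesis by (simp add: case_prod_beta')
  qed
  have "(\<lambda>p. T_kernel \<nu> (fst p * cnj (snd p))) \<in> borel_measurable (disk_area \<Otimes>\<^sub>M disk_area)"
    by (rule measurable_compose[OF _ measurable_T_kernel[OF assms(1,2)]]) (simp flip: case_prod_beta')
  then have "(\<lambda>(z, w). T_kernel \<nu> (z * cnj w) * f w) \<in> borel_measurable (disk_area \<Otimes>\<^sub>M disk_area)"
    unfolding case_prod_beta' by measurable
  then have "(\<lambda>z. \<integral>w. T_kernel \<nu> (z * cnj w) * f w \<partial>disk_area) \<in> borel_measurable disk_area"
    by (rule A.borel_measurable_lebesgue_integral)
  then show ?thesis by (simp add: T_op_eq[abs_def])
qed

theorem bounded_if_kernel_bound: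
  assumes \<nu>: "finite_measure \<nu>" "sets \<nu> = sets (restrict_space borel {0..1})"
    and c: "1 \<le> c" and B: "0 < B"
    and bound: "\<And>\<zeta>. cmod \<zeta> < 1 \<Longrightarrow> cmod (T_kernel \<nu> \<zeta>) \<le> B / cmod (1 - \<zeta>) powr (2 / c)"
  shows "bounded_L1_weak_Lp c (T_op \<nu>)"
  unfolding bounded_L1_weak_Lp_def
proof (intro exI[of _ "20736 * B"] conjI allI impI)
  show "0 \<le> 20736 * B" using B by simp
  fix f :: "complex \<Rightarrow> complex" assume f: "integrable disk_area f"
  have f_meas [measurable]: "f \<in> borel_measurable disk_area" using f by (rule borel_measurable_integrable)
  \<comment> \<open>The weak-type bound is applied to the measure with density \<open>\<bar>f\<bar>\<close>.\<close>
  define N where "N = density disk_area (\<lambda>w. ennreal (cmod (f w)))"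
  have setsN: "sets N = sets disk_area" by (simp add: N_def)
  have N_disk: "emeasure N (ball 0 1) = ennreal (\<integral>w. cmod (f w) \<partial>disk_area)"
  proof -
    have "emeasure N (space disk_area) = (\<integral>\<^sup>+w. ennreal (cmod (f w)) \<partial>disk_area)"
      unfolding N_def
      using f_meas sets.top[of disk_area] by (subst emeasure_density) (auto intro!: nn_integral_cong)
    also have "\<dots> = ennreal (\<integral>w. cmod (f w) \<partial>disk_area)"
      by (rule nn_integral_eq_integral) (use f in auto)
    finally show ?thesis by simp
  qed
  have finN: "finite_measure N"
    by (rule finite_measureI) (use N_disk sets_eq_imp_space_eq[OF setsN] in simp)
  have N_disk': "measure N (ball 0 1) = (\<integral>w. cmod (f w) \<partial>disk_area)"
    using N_disk by (simp add: measure_def)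
  have T_le: "cmod (T_op \<nu> f z) \<le> B * (\<integral>w. 1 / cmod (1 - z * cnj w) powr (2 / c) \<partial>N)"
    if z: "z \<in> ball 0 1" for z
  proof -
    have int: "integrable N (\<lambda>w. 1 / cmod (1 - z * cnj w) powr (2 / c))"
      using c by (intro integrable_kernel_power finN setsN z) auto
    then have meas: "(\<lambda>w. 1 / cmod (1 - z * cnj w) powr (2 / c)) \<in> borel_measurable disk_area"
      using borel_measurable_integrable measurable_cong_sets[OF setsN refl] by blast
    have f_norm: "(\<lambda>w. cmod (f w)) \<in> borel_measurable disk_area" by measurable
    have int': "integrable disk_area (\<lambda>w. cmod (f w) * (1 / cmod (1 - z * cnj w) powr (2 / c)))"
      using int integrable_density[OF meas f_norm] by (simp add: N_def)
    have eq: "(\<integral>w. 1 / cmod (1 - z * cnj w) powr (2 / c) \<partial>N)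
        = (\<integral>w. cmod (f w) * (1 / cmod (1 - z * cnj w) powr (2 / c)) \<partial>disk_area)"
      using integral_density[OF meas f_norm] by (simp add: N_def)
    have "cmod (T_op \<nu> f z) \<le> (\<integral>w. cmod (T_kernel \<nu> (z * cnj w) * f w) \<partial>disk_area)"
      unfolding T_op_eq by (rule integral_norm_bound)
    also have "\<dots> \<le> (\<integral>w. B * (cmod (f w) * (1 / cmod (1 - z * cnj w) powr (2 / c))) \<partial>disk_area)"
    proof (rule integral_mono')
      show "integrable disk_area (\<lambda>w. B * (cmod (f w) * (1 / cmod (1 - z * cnj w) powr (2 / c))))"
        by (rule integrable_mult_right) (use int' in simp)
      fix w assume "w \<in> space disk_area"
      then have "cmod (z * cnj w) < 1"
        using z mult_left_le[of "cmod w" "cmod z"] by (simp add: norm_mult)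
      from mult_right_mono[OF bound[OF this], of "cmod (f w)"]
      show "cmod (T_kernel \<nu> (z * cnj w) * f w) \<le> B * (cmod (f w) * (1 / cmod (1 - z * cnj w) powr (2 / c)))"
        by (simp add: norm_mult mult_ac)
    qed (use B in auto)
    also have "\<dots> = B * (\<integral>w. 1 / cmod (1 - z * cnj w) powr (2 / c) \<partial>N)"
      unfolding eq by (rule integral_mult_right_zero)
    finally show ?thesis .
  qed
  have weak: "weak_norm c (T_op \<nu> f) \<le> ennreal (20736 * B * (\<integral>z. cmod (f z) \<partial>disk_area))"
  proof (rule weak_norm_le)
    show "0 \<le> 20736 * B * (\<integral>z. cmod (f z) \<partial>disk_area)" using B by simp
    fix C t :: real assume C: "20736 * B * (\<integral>z. cmod (f z) \<partial>disk_area) < C" and t: "0 < t"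
    define a where "a = C / (20736 * B)"
    have a: "measure N (ball 0 1) < a" using C B by (simp add: N_disk' a_def field_simps)
    then have a0: "0 < a" using measure_nonneg[of N "ball 0 1"] by linarith
    have "{z \<in> ball 0 1. t < cmod (T_op \<nu> f z)}
      \<subseteq> {z \<in> ball 0 1. t / B < (\<integral>w. 1 / cmod (1 - z * cnj w) powr (2 / c) \<partial>N)}"
      using B T_le by (auto simp: pos_divide_less_eq mult.commute intro: less_le_trans)
    then have "measure disk_area {z \<in> ball 0 1. t < cmod (T_op \<nu> f z)} \<le> 10368 * (2 * a / (t / B)) powr c"
      using t B by (intro weak_type_kernel_power[OF finN setsN _ c a]) auto
    also have "\<dots> \<le> 10368 powr c * (2 * a / (t / B)) powr c"
      using c powr_mono[of 1 c "10368::real"] by (intro mult_right_mono) auto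
    also have "\<dots> = (10368 * (2 * a / (t / B))) powr c"
      by (rule powr_mult[symmetric])
    also have "10368 * (2 * a / (t / B)) = C / t" using B by (simp add: a_def)
    also have "(C / t) powr c = C powr c / t powr c"
      by (rule powr_divide)
    finally show "measure disk_area {z \<in> ball 0 1. t < cmod (T_op \<nu> f z)} \<le> C powr c / t powr c" .
  qed
  then show "weak_norm c (T_op \<nu> f) \<le> ennreal (20736 * B * (\<integral>z. cmod (f z) \<partial>disk_area))" .
  show "T_op \<nu> f \<in> weak_Lp c"
    using weak measurable_T_op[OF \<nu> f_meas] by (auto simp: weak_Lp_def intro: le_less_trans)
qed

section \<open>Size of the kernel\<close>

lemma space_unit_interval:
  "sets \<nu> = sets (restrict_space borel {0..1::real}) \<Longrightarrow> space \<nu> = {0..1}"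
  by (drule sets_eq_imp_space_eq) (simp add: space_restrict_space)

lemma sets_unit_interval:
  assumes "sets \<nu> = sets (restrict_space borel {0..1::real})" "A \<in> sets borel" "A \<subseteq> {0..1}"
  shows "A \<in> sets \<nu>"
  using assms by (simp add: sets_restrict_space_iff)

lemma one_minus_scaled_ge:
  assumes "cmod \<zeta> \<le> 1" "0 \<le> r" "r \<le> 1"
  shows "1 - r \<le> cmod (1 - of_real r * \<zeta>)" "cmod (1 - \<zeta>) \<le> 2 * cmod (1 - of_real r * \<zeta>)"
    "1 - cmod \<zeta> \<le> cmod (1 - of_real r * \<zeta>)"
proof -
  have "1 - r * cmod \<zeta> \<le> cmod (1 - of_real r * \<zeta>)"
    using norm_triangle_ineq2[of 1 "of_real r * \<zeta>"] assms by (simp add: norm_mult)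
  moreover have "r * cmod \<zeta> \<le> r" "r * cmod \<zeta> \<le> cmod \<zeta>"
    using assms by (auto simp: mult_left_le mult_left_le_one_le)
  ultimately show 1: "1 - r \<le> cmod (1 - of_real r * \<zeta>)" and "1 - cmod \<zeta> \<le> cmod (1 - of_real r * \<zeta>)"
    by linarith+
  have "1 - \<zeta> = (1 - of_real r * \<zeta>) - of_real (1 - r) * \<zeta>" by (simp add: algebra_simps)
  then have "cmod (1 - \<zeta>) \<le> cmod (1 - of_real r * \<zeta>) + cmod (of_real (1 - r) * \<zeta>)"
    using norm_triangle_ineq4 by metis
  also have "cmod (of_real (1 - r) * \<zeta>) \<le> 1 - r"
    unfolding norm_mult norm_of_real using assms by (simp add: mult_left_le)
  finally show "cmod (1 - \<zeta>) \<le> 2 * cmod (1 - of_real r * \<zeta>)" using 1 by linarith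
qed

lemma norm_T_kernel_le:
  assumes "integrable \<nu> g" "AE r in \<nu>. 1 / cmod (1 - of_real r * \<zeta>) \<le> g r"
  shows "cmod (T_kernel \<nu> \<zeta>) \<le> (\<integral>r. g r \<partial>\<nu>) / cmod (1 - \<zeta>)"
proof -
  have "cmod (\<integral>r. 1 / (1 - of_real r * \<zeta>) \<partial>\<nu>) \<le> (\<integral>r. cmod (1 / (1 - of_real r * \<zeta>)) \<partial>\<nu>)"
    by (rule integral_norm_bound)
  also have "\<dots> \<le> (\<integral>r. g r \<partial>\<nu>)"
    using assms by (intro integral_mono_AE') (auto simp: norm_divide elim!: eventually_mono intro: order_trans[rotated])
  finally show ?thesis
    by (simp add: T_kernel_def norm_mult norm_divide divide_right_mono)
qed

lemma T_kernel_bound_general: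
  assumes \<nu>: "finite_measure \<nu>" "sets \<nu> = sets (restrict_space borel {0..1})" and \<zeta>: "cmod \<zeta> < 1"
  shows "cmod (T_kernel \<nu> \<zeta>) \<le> (2 * measure \<nu> {0..1} + 1) / cmod (1 - \<zeta>) powr (2 / 1)"
proof -
  interpret finite_measure \<nu> by (rule \<nu>)
  have sp: "space \<nu> = {0..1}" by (rule space_unit_interval[OF \<nu>(2)])
  have d: "0 < cmod (1 - \<zeta>)" using \<zeta> by auto
  have "cmod (T_kernel \<nu> \<zeta>) \<le> (\<integral>r. 2 / cmod (1 - \<zeta>) \<partial>\<nu>) / cmod (1 - \<zeta>)"
  proof (rule norm_T_kernel_le)
    show "AE r in \<nu>. 1 / cmod (1 - of_real r * \<zeta>) \<le> 2 / cmod (1 - \<zeta>)"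
    proof (rule AE_I2)
      fix r assume "r \<in> space \<nu>"
      then have r: "cmod (1 - \<zeta>) \<le> 2 * cmod (1 - of_real r * \<zeta>)"
        using \<zeta> by (intro one_minus_scaled_ge) (auto simp: sp)
      then have "0 < cmod (1 - of_real r * \<zeta>)" using d by linarith
      then show "1 / cmod (1 - of_real r * \<zeta>) \<le> 2 / cmod (1 - \<zeta>)" using r d by (simp add: field_simps)
    qed
  qed simp
  also have "\<dots> = 2 * measure \<nu> {0..1} / (cmod (1 - \<zeta>))\<^sup>2" by (simp add: sp power2_eq_square)
  also have "\<dots> \<le> (2 * measure \<nu> {0..1} + 1) / (cmod (1 - \<zeta>))\<^sup>2" by (intro divide_right_mono) auto
  finally show ?thesis using d by simp
qed

lemma AE_less_1:
  assumes \<nu>: "sets \<nu> = sets (restrict_space borel {0..1::real})" and "emeasure \<nu> {1} = 0"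
  shows "AE r in \<nu>. 0 \<le> r \<and> r < 1"
proof (rule AE_I)
  show "{r \<in> space \<nu>. \<not> (0 \<le> r \<and> r < 1)} \<subseteq> {1}" by (auto simp: space_unit_interval[OF \<nu>])
  show "{1} \<in> sets \<nu>" by (rule sets_unit_interval[OF \<nu>]) auto
qed (rule assms(2))

lemma T_kernel_bound_hyperbolic:
  assumes \<nu>: "finite_measure \<nu>" "sets \<nu> = sets (restrict_space borel {0..1})"
    and no_atom: "emeasure \<nu> {1} = 0" and hyp: "hyperbolic_integrable \<nu>"
  obtains B where "0 < B" "\<And>\<zeta>. cmod \<zeta> < 1 \<Longrightarrow> cmod (T_kernel \<nu> \<zeta>) \<le> B / cmod (1 - \<zeta>) powr (2 / 2)"
proof
  define g where "g = (\<lambda>r::real. 2 * (1 / (1 - r\<^sup>2) * indicator {0..<1} r))"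
  have g0: "0 \<le> g r" for r
    by (auto simp: g_def indicator_def power_le_one)
  have "(\<integral>\<^sup>+r. ennreal (1 / (1 - r\<^sup>2) * indicator {0..<1} r) \<partial>\<nu>)
      = (\<integral>\<^sup>+ r\<in>{0..<1}. ennreal (1 / (1 - r\<^sup>2)) \<partial>\<nu>)"
    by (intro nn_integral_cong) (auto simp: indicator_def)
  then have "integrable \<nu> (\<lambda>r. 1 / (1 - r\<^sup>2) * indicator {0..<1} r)"
    using hyp unfolding hyperbolic_integrable_def
    by (intro integrableI_nonneg measurable_unit_interval_borel[OF \<nu>(2)])
       (auto simp: indicator_def power_le_one)
  then have g: "integrable \<nu> g" unfolding g_def by (rule integrable_mult_right)
  show "0 < (\<integral>r. g r \<partial>\<nu>) + 1" using g0 by (simp add: add_nonneg_pos)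
  fix \<zeta> :: complex assume \<zeta>: "cmod \<zeta> < 1"
  then have d: "0 < cmod (1 - \<zeta>)" by auto
  have "cmod (T_kernel \<nu> \<zeta>) \<le> (\<integral>r. g r \<partial>\<nu>) / cmod (1 - \<zeta>)"
  proof (rule norm_T_kernel_le[OF g])
    show "AE r in \<nu>. 1 / cmod (1 - of_real r * \<zeta>) \<le> g r"
      using AE_less_1[OF \<nu>(2) no_atom]
    proof (rule eventually_mono)
      fix r :: real assume r: "0 \<le> r \<and> r < 1"
      have "1 / cmod (1 - of_real r * \<zeta>) \<le> 1 / (1 - r)"
        using r \<zeta> one_minus_scaled_ge(1)[of \<zeta> r] by (intro divide_left_mono mult_pos_pos) auto
      also have "\<dots> = (1 + r) / (1 - r\<^sup>2)"
      proof -
        have "1 - r\<^sup>2 = (1 + r) * (1 - r)" by (simp add: power2_eq_square algebra_simps)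
        then show ?thesis using r by simp
      qed
      also have "\<dots> \<le> 2 / (1 - r\<^sup>2)" using r by (intro divide_right_mono) (auto simp: power_le_one)
      also have "\<dots> = g r" using r by (simp add: g_def)
      finally show "1 / cmod (1 - of_real r * \<zeta>) \<le> g r" .
    qed
  qed
  also have "\<dots> \<le> ((\<integral>r. g r \<partial>\<nu>) + 1) / cmod (1 - \<zeta>)" by (intro divide_right_mono) auto
  finally show "cmod (T_kernel \<nu> \<zeta>) \<le> ((\<integral>r. g r \<partial>\<nu>) + 1) / cmod (1 - \<zeta>) powr (2 / 2)"
    using d by simp
qed

lemma Carleson_condition_iff:
  assumes \<nu>: "finite_measure \<nu>"
  shows "Carleson_condition \<alpha> \<nu> \<longleftrightarrow> (\<exists>C. \<forall>t\<in>{0<..1}. measure \<nu> {1 - t..<1} \<le> C * t powr \<alpha>)"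
proof -
  interpret finite_measure \<nu> by (rule \<nu>)
  have quot: "emeasure \<nu> {1 - t..<1} / ennreal (t powr \<alpha>) = ennreal (measure \<nu> {1 - t..<1} / t powr \<alpha>)"
    if "0 < t" for t
    using that by (simp add: emeasure_eq_measure divide_ennreal)
  show ?thesis
  proof
    assume "Carleson_condition \<alpha> \<nu>"
    then obtain C where C: "0 \<le> C" "(SUP t\<in>{0<..1}. emeasure \<nu> {1 - t..<1} / ennreal (t powr \<alpha>)) = ennreal C"
      unfolding Carleson_condition_def by (auto simp: less_top_ennreal)
    have "measure \<nu> {1 - t..<1} \<le> C * t powr \<alpha>" if t: "t \<in> {0<..1}" for t
    proof -
      have "ennreal (measure \<nu> {1 - t..<1} / t powr \<alpha>) \<le> ennreal C"
        using SUP_upper[OF t, of "\<lambda>t. emeasure \<nu> {1 - t..<1} / ennreal (t powr \<alpha>)"] quot[of t] t C by simp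
      then show ?thesis using C(1) t by (simp add: ennreal_le_iff field_simps)
    qed
    then show "\<exists>C. \<forall>t\<in>{0<..1}. measure \<nu> {1 - t..<1} \<le> C * t powr \<alpha>" by blast
  next
    assume "\<exists>C. \<forall>t\<in>{0<..1}. measure \<nu> {1 - t..<1} \<le> C * t powr \<alpha>"
    then obtain C where C: "\<forall>t\<in>{0<..1}. measure \<nu> {1 - t..<1} \<le> C * t powr \<alpha>" by blast
    have "(SUP t\<in>{0<..1}. emeasure \<nu> {1 - t..<1} / ennreal (t powr \<alpha>)) \<le> ennreal C"
    proof (rule SUP_least)
      fix t :: real assume t: "t \<in> {0<..1}"
      then show "emeasure \<nu> {1 - t..<1} / ennreal (t powr \<alpha>) \<le> ennreal C"
        using C by (subst quot) (auto intro!: ennreal_leI simp: field_simps)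
    qed
    then show "Carleson_condition \<alpha> \<nu>"
      unfolding Carleson_condition_def using ennreal_less_top order_le_less_trans by (metis infinity_ennreal_def)
  qed
qed

text \<open>
The interval \<open>[0,1)\<close> is covered by the sets \<open>1 - r \<le> 2 ^ k * d\<close>, \<open>k \<le> K\<close>, with \<open>d = cmod (1 - \<zeta>)\<close>;
where \<open>1 - r\<close> is about \<open>2 ^ k * d\<close> the inner integrand is at most \<open>4 / (2 ^ k * d)\<close>. The
Carleson condition with exponent \<open>\<alpha> = 2 * (1 - 1 / c) < 1\<close> turns the sum of these contributions into
a geometric series, of order \<open>d powr (\<alpha> - 1)\<close>.
\<close>

lemma T_kernel_bound_Carleson:
  assumes \<nu>: "finite_measure \<nu>" "sets \<nu> = sets (restrict_space borel {0..1})"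
    and no_atom: "emeasure \<nu> {1} = 0" and c: "1 < c" "c < 2"
    and Carleson: "Carleson_condition (2 * (1 - 1 / c)) \<nu>"
  obtains B where "0 < B" "\<And>\<zeta>. cmod \<zeta> < 1 \<Longrightarrow> cmod (T_kernel \<nu> \<zeta>) \<le> B / cmod (1 - \<zeta>) powr (2 / c)"
proof -
  interpret finite_measure \<nu> by (rule \<nu>)
  define \<alpha> where "\<alpha> = 2 * (1 - 1 / c)"
  have \<alpha>: "0 < \<alpha>" "\<alpha> < 1" using c by (auto simp: \<alpha>_def field_simps)
  define q where "q = 2 powr (\<alpha> - 1)"
  have q: "0 < q" "q < 1" using \<alpha> powr_less_one[of 2 "\<alpha> - 1"] by (auto simp: q_def)
  obtain C0 where C0: "\<And>t. t \<in> {0<..1} \<Longrightarrow> measure \<nu> {1 - t..<1} \<le> C0 * t powr \<alpha>"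
    using Carleson Carleson_condition_iff[OF \<nu>(1)] unfolding \<alpha>_def by blast
  \<comment> \<open>A strictly positive constant is needed for a strictly positive bound \<open>B\<close>.\<close>
  define C where "C = max C0 1"
  have C: "measure \<nu> {1 - t..<1} \<le> C * t powr \<alpha>" if "t \<in> {0<..1}" for t
    using C0[OF that] mult_right_mono[of C0 C "t powr \<alpha>"] by (simp add: C_def)
  have C1: "1 \<le> C" by (simp add: C_def)
  have pos: "0 < 4 * C / (1 - q)" using q C1 by simp
  have bound: "cmod (T_kernel \<nu> \<zeta>) \<le> 4 * C / (1 - q) / cmod (1 - \<zeta>) powr (2 / c)"
    if \<zeta>: "cmod \<zeta> < 1" for \<zeta>
  proof -
  define d where "d = cmod (1 - \<zeta>)"
  have d: "0 < d" using \<zeta> by (auto simp: d_def)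
  obtain K where K: "1 / d < 2 ^ K" using real_arch_pow[of 2 "1 / d"] by auto
  then have K: "1 \<le> 2 ^ K * d" using d by (simp add: field_simps)
  define I where "I = (\<lambda>k::nat. {1 - min 1 (2 ^ k * d)..<1})"
  have I_sets: "I k \<in> sets \<nu>" for k by (intro sets_unit_interval[OF \<nu>(2)]) (auto simp: I_def)
  define g where "g = (\<lambda>r. \<Sum>k\<le>K. 4 / (2 ^ k * d) * indicat_real (I k) r)"
  have int_I: "integrable \<nu> (\<lambda>r. 4 / (2 ^ k * d) * indicat_real (I k) r)" for k
    using I_sets by (intro integrable_mult_right) (simp add: less_top[symmetric])
  have g: "integrable \<nu> g" unfolding g_def by (intro Bochner_Integration.integrable_sum int_I)
  have "(\<integral>r. g r \<partial>\<nu>) = (\<Sum>k\<le>K. 4 / (2 ^ k * d) * measure \<nu> (I k))"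
    unfolding g_def using sets.sets_into_space[OF I_sets]
    by (subst Bochner_Integration.integral_sum[OF int_I]) (simp add: Int_absorb2)
  also have "\<dots> \<le> (\<Sum>k\<le>K. 4 * C * d powr (\<alpha> - 1) * q ^ k)"
  proof (rule sum_mono)
    fix k
    define u where "u = 2 ^ k * d"
    have u: "0 < u" using d by (simp add: u_def)
    have "measure \<nu> (I k) \<le> C * min 1 u powr \<alpha>"
      unfolding I_def u_def[symmetric] using u by (intro C) auto
    also have "\<dots> \<le> C * u powr \<alpha>" using u \<alpha> C1 by (intro mult_left_mono powr_mono2) auto
    finally have "4 / u * measure \<nu> (I k) \<le> 4 / u * (C * u powr \<alpha>)"
      using u by (intro mult_left_mono) auto
    also have "\<dots> = 4 * C * u powr (\<alpha> - 1)" using u by (simp add: powr_diff)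
    also have "u powr (\<alpha> - 1) = d powr (\<alpha> - 1) * q ^ k"
    proof -
      have "(2 ^ k) powr (\<alpha> - 1) = q ^ k"
      proof -
        have "(2 ^ k) powr (\<alpha> - 1) = (2 powr real k) powr (\<alpha> - 1)" by (subst powr_realpow) auto
        also have "\<dots> = q powr real k" unfolding q_def powr_powr by (simp only: mult.commute)
        also have "\<dots> = q ^ k" using q(1) by (rule powr_realpow)
        finally show ?thesis .
      qed
      then show ?thesis using d by (simp add: u_def powr_mult mult.commute)
    qed
    finally show "4 / (2 ^ k * d) * measure \<nu> (I k) \<le> 4 * C * d powr (\<alpha> - 1) * q ^ k"
      by (simp add: u_def mult.assoc)
  qed
  also have "\<dots> = 4 * C * d powr (\<alpha> - 1) * (\<Sum>k\<le>K. q ^ k)" by (simp add: sum_distrib_left)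
  also have "\<dots> \<le> 4 * C * d powr (\<alpha> - 1) * (1 / (1 - q))"
  proof (intro mult_left_mono)
    have "(\<Sum>k\<le>K. q ^ k) \<le> (\<Sum>k. q ^ k)"
      using q by (intro sum_le_suminf summable_geometric) auto
    then show "(\<Sum>k\<le>K. q ^ k) \<le> 1 / (1 - q)" using q by (simp add: suminf_geometric)
  qed (use C1 in auto)
  finally have int_g: "(\<integral>r. g r \<partial>\<nu>) \<le> 4 * C / (1 - q) * d powr (\<alpha> - 1)" by simp
  have "cmod (T_kernel \<nu> \<zeta>) \<le> (\<integral>r. g r \<partial>\<nu>) / d"
    unfolding d_def
  proof (rule norm_T_kernel_le[OF g])
    show "AE r in \<nu>. 1 / cmod (1 - of_real r * \<zeta>) \<le> g r"
      using AE_less_1[OF \<nu>(2) no_atom]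
    proof (rule eventually_mono)
      fix r :: real assume r: "0 \<le> r \<and> r < 1"
      define b where "b = cmod (1 - of_real r * \<zeta>)"
      have b: "1 - r \<le> b" "d \<le> 2 * b"
        using one_minus_scaled_ge[of \<zeta> r] r \<zeta> by (auto simp: b_def d_def)
      then have b0: "0 < b" using r by linarith
      define k where "k = (LEAST k. 1 - r \<le> 2 ^ k * d)"
      have ex: "1 - r \<le> 2 ^ K * d" using K r by linarith
      have k1: "1 - r \<le> 2 ^ k * d" unfolding k_def using ex by (rule LeastI)
      have kK: "k \<le> K" unfolding k_def using ex by (rule Least_le)
      have "2 ^ k * d \<le> 4 * b"
      proof (cases k)
        case 0
        then show ?thesis using b b0 by simp
      next
        case (Suc k')
        then have "\<not> 1 - r \<le> 2 ^ k' * d" using not_less_Least[of k'] by (metis lessI k_def)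
        then have "2 ^ k' * d < b" using b(1) by linarith
        moreover have "2 ^ k * d = 2 * (2 ^ k' * d)" using Suc by simp
        ultimately show ?thesis using b0 by linarith
      qed
      then have "1 / b \<le> 4 / (2 ^ k * d)" using b0 d by (simp add: field_simps)
      also have "\<dots> = 4 / (2 ^ k * d) * indicat_real (I k) r"
      proof -
        have "r \<in> I k" using k1 r by (auto simp: I_def min_def)
        then show ?thesis by simp
      qed
      also have "\<dots> \<le> g r"
        unfolding g_def using kK d
        by (intro member_le_sum[of k _ "\<lambda>k. 4 / (2 ^ k * d) * indicat_real (I k) r"]) auto
      finally show "1 / cmod (1 - of_real r * \<zeta>) \<le> g r" by (simp add: b_def)
    qed
  qed
  also have "\<dots> \<le> 4 * C / (1 - q) * d powr (\<alpha> - 1) / d"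
    using int_g d by (intro divide_right_mono) auto
  also have "\<dots> = 4 * C / (1 - q) / d powr (2 / c)"
  proof -
    have "2 / c = 1 - (\<alpha> - 1)" by (simp add: \<alpha>_def)
    then show ?thesis using d by (simp only: powr_diff powr_one) simp
  qed
  finally show ?thesis by (simp add: d_def)
  qed
  show thesis by (rule that[OF pos bound])
qed

text \<open>
For \<open>c > 1\<close> the weight in the definition of the critical index is infinite at \<open>1\<close>.
\<close>

lemma no_atom_at_1:
  assumes fin: "finite_measure \<nu>" and \<nu>: "sets \<nu> = sets (restrict_space borel {0..1})"
    and "1 < critical_index \<nu>"
  shows "emeasure \<nu> {1} = 0"
proof -
  let ?S = "{c. 1 \<le> c \<and> c < 2 \<and> (\<integral>\<^sup>+ r. hyp_weight (two_over_dual c) r \<partial>\<nu>) < \<infinity>}"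
  have "(\<integral>\<^sup>+ r. hyp_weight (two_over_dual 1) r \<partial>\<nu>) = emeasure \<nu> (space \<nu>)"
    by (simp add: two_over_dual_eq hyp_weight_def)
  then have "1 \<in> ?S"
    using finite_measure.emeasure_finite[OF fin, of "space \<nu>"] by (auto simp: less_top)
  then have "?S \<noteq> {}" by blast
  moreover have "bdd_above ?S" by (rule bdd_aboveI[of _ 2]) auto
  ultimately obtain c where c: "c \<in> ?S" "1 < c"
    using assms(3) less_cSup_iff[of ?S 1] unfolding critical_index_def by blast
  have "0 < two_over_dual c" using c by (simp add: two_over_dual_eq field_simps)
  have "\<infinity> * emeasure \<nu> {1} = (\<integral>\<^sup>+ r. \<infinity> * indicator {1} r \<partial>\<nu>)"
    using sets_unit_interval[OF \<nu>, of "{1}"] by (simp add: nn_integral_cmult_indicator)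
  also have "\<dots> \<le> (\<integral>\<^sup>+ r. hyp_weight (two_over_dual c) r \<partial>\<nu>)"
    using \<open>0 < two_over_dual c\<close> by (intro nn_integral_mono) (auto simp: indicator_def hyp_weight_at_1)
  also have "\<dots> < \<infinity>" using c by simp
  finally show ?thesis by (auto simp: ennreal_top_mult split: if_splits)
qed

section \<open>Necessary conditions\<close>

text \<open>
The size of the inner integral of the kernel at distance about \<open>t\<close> from the boundary point \<open>1\<close>. The
factor \<open>5 / 4\<close> is the one that arises in \<open>Re_T_kernel_ge\<close>.
\<close>

definition boundary_potential :: "real measure \<Rightarrow> real \<Rightarrow> real" where
  "boundary_potential \<nu> t = (\<integral>r. 1 / ((1 - r) + 5 * t / 4) \<partial>\<nu>)"

lemma integrable_boundary_potential:
  fixes \<nu> :: "real measure"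
  assumes \<nu>: "finite_measure \<nu>" "sets \<nu> = sets (restrict_space borel {0..1})" and "0 < t"
  shows "integrable \<nu> (\<lambda>r. 1 / ((1 - r) + 5 * t / 4))"
proof -
  interpret finite_measure \<nu> by (rule \<nu>)
  have "(\<lambda>r. 1 / ((1 - r) + 5 * t / 4)) \<in> borel_measurable \<nu>"
    by (rule measurable_unit_interval_borel[OF \<nu>(2)]) measurable
  moreover have "norm (1 / ((1 - r) + 5 * t / 4)) \<le> 1 / (5 * t / 4)" if "r \<in> space \<nu>" for r
  proof -
    have r: "0 \<le> r" "r \<le> 1" using that by (auto simp: space_unit_interval[OF \<nu>(2)])
    then have "1 / ((1 - r) + 5 * t / 4) \<le> 1 / (5 * t / 4)"
      using \<open>0 < t\<close> by (intro divide_left_mono mult_pos_pos add_nonneg_pos) auto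
    then show ?thesis using r \<open>0 < t\<close> by simp
  qed
  ultimately show ?thesis by (intro integrable_const_bound AE_I2) auto
qed

lemma integrable_inner_kernel:
  assumes \<nu>: "finite_measure \<nu>" "sets \<nu> = sets (restrict_space borel {0..1})" and \<zeta>: "cmod \<zeta> < 1"
  shows "integrable \<nu> (\<lambda>r. 1 / (1 - complex_of_real r * \<zeta>))"
proof -
  interpret finite_measure \<nu> by (rule \<nu>)
  have "(\<lambda>r. 1 / (1 - complex_of_real r * \<zeta>)) \<in> borel_measurable \<nu>"
    by (rule measurable_unit_interval_borel[OF \<nu>(2)]) measurable
  moreover have "norm (1 / (1 - complex_of_real r * \<zeta>)) \<le> 1 / (1 - cmod \<zeta>)" if "r \<in> space \<nu>" for r
  proof -
    have "1 - cmod \<zeta> \<le> cmod (1 - of_real r * \<zeta>)"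
      using that \<zeta> by (intro one_minus_scaled_ge) (auto simp: space_unit_interval[OF \<nu>(2)])
    then show ?thesis using \<zeta> by (simp add: norm_divide) (intro divide_left_mono mult_pos_pos, auto)
  qed
  ultimately show ?thesis by (intro integrable_const_bound AE_I2) auto
qed

lemma norm_T_kernel_le_crude:
  assumes \<nu>: "finite_measure \<nu>" "sets \<nu> = sets (restrict_space borel {0..1})"
    and \<zeta>: "cmod \<zeta> \<le> s" "s < 1"
  shows "cmod (T_kernel \<nu> \<zeta>) \<le> (2 * measure \<nu> {0..1} + 1) / (1 - s)\<^sup>2"
proof -
  have d: "1 - s \<le> cmod (1 - \<zeta>)" using norm_triangle_ineq2[of 1 \<zeta>] \<zeta> by simp
  have "cmod (T_kernel \<nu> \<zeta>) \<le> (2 * measure \<nu> {0..1} + 1) / (cmod (1 - \<zeta>))\<^sup>2"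
    using T_kernel_bound_general[OF \<nu>, of \<zeta>] \<zeta> d by simp
  also have "\<dots> \<le> (2 * measure \<nu> {0..1} + 1) / (1 - s)\<^sup>2"
    using d \<zeta> by (intro divide_left_mono power_mono) (auto intro!: mult_pos_pos add_nonneg_nonneg)
  finally show ?thesis .
qed

text \<open>
In a narrow sector around the positive real axis there is no cancellation in the product of the two
factors of the kernel.
\<close>

lemma Re_inverse_mult_ge:
  assumes a: "\<bar>Im a\<bar> \<le> Re a / 3" "0 < Re a" and b: "\<bar>Im b\<bar> \<le> Re b / 3" "0 < Re b"
  shows "1 / (2 * Re a * Re b) \<le> Re (1 / a * (1 / b))"
proof -
  define x y where "x = Re a" and "y = Re b"
  have xy: "0 < x" "0 < y" using a b by (auto simp: x_def y_def)
  have "\<bar>Im a * Im b\<bar> \<le> (x / 3) * (y / 3)"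
    unfolding abs_mult x_def y_def using a b by (intro mult_mono) auto
  then have re: "8 / 9 * (x * y) \<le> Re (a * b)" by (simp add: x_def y_def)
  have sq: "(cmod v)\<^sup>2 \<le> 10 / 9 * (Re v)\<^sup>2" if "\<bar>Im v\<bar> \<le> Re v / 3" for v
  proof -
    have "(Im v)\<^sup>2 \<le> (Re v / 3)\<^sup>2" using that by (simp add: power2_le_iff_abs_le abs_le_square_iff[symmetric])
    then show ?thesis by (simp add: cmod_power2 power_divide)
  qed
  have "(cmod (a * b))\<^sup>2 \<le> (10 / 9 * x\<^sup>2) * (10 / 9 * y\<^sup>2)"
    unfolding norm_mult power_mult_distrib x_def y_def using sq[OF a(1)] sq[OF b(1)] by (intro mult_mono) auto
  then have nm: "(cmod (a * b))\<^sup>2 \<le> 100 / 81 * (x * y)\<^sup>2" by (simp add: power_mult_distrib)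
  have ab0: "0 < (cmod (a * b))\<^sup>2" using xy by (auto simp: x_def y_def)
  have "1 / (2 * Re a * Re b) = (100 / 81 * (x * y)\<^sup>2) / (200 / 81 * (x * y) ^ 3)"
    using xy by (simp add: x_def y_def power2_eq_square power3_eq_cube)
  also have "\<dots> = 1 / (2 * (x * y))"
    using xy by (simp add: power2_eq_square power3_eq_cube)
  also have "\<dots> \<le> (8 / 9 * (x * y)) / (100 / 81 * (x * y)\<^sup>2)"
    using xy by (simp add: field_simps power2_eq_square)
  also have "\<dots> \<le> Re (a * b) / (cmod (a * b))\<^sup>2"
  proof (rule frac_le)
    have "0 < x * y" using xy by simp
    then show "0 \<le> Re (a * b)" using re by linarith
  qed (use re nm ab0 in auto)
  also have "\<dots> = Re (1 / a * (1 / b))"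
    by (simp add: Re_divide cmod_power2 flip: of_real_power)
  finally show ?thesis .
qed

lemma Re_T_kernel_ge:
  assumes \<nu>: "finite_measure \<nu>" "sets \<nu> = sets (restrict_space borel {0..1})"
    and \<zeta>: "cmod \<zeta> < 1" and t: "0 < t" "cmod (1 - \<zeta> - of_real t) \<le> t / 4"
  shows "2 / (5 * t) * boundary_potential \<nu> t \<le> Re (T_kernel \<nu> \<zeta>)"
proof -
  define a where "a = 1 - \<zeta>"
  have a: "3 / 4 * t \<le> Re a" "Re a \<le> 5 / 4 * t" "\<bar>Im a\<bar> \<le> t / 4"
    using abs_Re_le_cmod[of "a - of_real t"] abs_Im_le_cmod[of "a - of_real t"] t(2)
    by (auto simp: a_def)
  have int: "integrable \<nu> (\<lambda>r. 1 / a * (1 / (1 - complex_of_real r * \<zeta>)))"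
    by (rule integrable_mult_right) (rule integrable_inner_kernel[OF \<nu> \<zeta>])
  have "2 / (5 * t) * boundary_potential \<nu> t = (\<integral>r. 2 / (5 * t) * (1 / ((1 - r) + 5 * t / 4)) \<partial>\<nu>)"
    unfolding boundary_potential_def by (rule integral_mult_right_zero[symmetric])
  also have "\<dots> \<le> (\<integral>r. Re (1 / a * (1 / (1 - complex_of_real r * \<zeta>))) \<partial>\<nu>)"
  proof (rule integral_mono)
    show "integrable \<nu> (\<lambda>r. 2 / (5 * t) * (1 / ((1 - r) + 5 * t / 4)))"
      by (rule integrable_mult_right) (rule integrable_boundary_potential[OF \<nu> t(1)])
    show "integrable \<nu> (\<lambda>r. Re (1 / a * (1 / (1 - complex_of_real r * \<zeta>))))"
      using int by (rule integrable_Re)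
    fix r assume "r \<in> space \<nu>"
    then have r: "0 \<le> r" "r \<le> 1" by (auto simp: space_unit_interval[OF \<nu>(2)])
    define b where "b = 1 - complex_of_real r * \<zeta>"
    have Reb: "Re b = (1 - r) + r * Re a" and Imb: "Im b = r * Im a"
      by (simp_all add: a_def b_def algebra_simps)
    have a3: "\<bar>Im a\<bar> \<le> Re a / 3" "0 < Re a" using a t(1) by linarith+
    have "r * \<bar>Im a\<bar> \<le> r * (Re a / 3)" using a3 r by (intro mult_left_mono) auto
    then have b1: "\<bar>Im b\<bar> \<le> Re b / 3" using r by (simp add: Reb Imb abs_mult)
    have b2: "0 < Re b"
    proof (cases "r = 1")
      case False
      then show ?thesis using r a3 by (simp add: Reb add_pos_nonneg)
    qed (use a3 in \<open>simp add: Reb\<close>)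
    have "r * Re a \<le> 1 * Re a" using r a3 by (intro mult_right_mono) auto
    then have b3: "Re b \<le> (1 - r) + 5 * t / 4" using a by (simp add: Reb)
    have "2 / (5 * t) * (1 / ((1 - r) + 5 * t / 4)) = 1 / (2 * (5 / 4 * t) * ((1 - r) + 5 * t / 4))"
      by simp
    also have "\<dots> \<le> 1 / (2 * Re a * Re b)"
      using a a3 b2 b3 t by (intro divide_left_mono mult_mono mult_pos_pos) auto
    also have "\<dots> \<le> Re (1 / a * (1 / b))" by (rule Re_inverse_mult_ge[OF a3 b1 b2])
    finally show "2 / (5 * t) * (1 / ((1 - r) + 5 * t / 4)) \<le> Re (1 / a * (1 / (1 - complex_of_real r * \<zeta>)))"
      by (simp add: b_def)
  qed
  also have "\<dots> = Re (\<integral>r. 1 / a * (1 / (1 - complex_of_real r * \<zeta>)) \<partial>\<nu>)"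
    using integral_Re[OF int] by simp
  also have "(\<integral>r. 1 / a * (1 / (1 - complex_of_real r * \<zeta>)) \<partial>\<nu>) = T_kernel \<nu> \<zeta>"
    unfolding T_kernel_def a_def by (rule integral_mult_right_zero)
  finally show ?thesis .
qed

text \<open>
The test function is the indicator of \<open>E\<close>, the part in the unit disk of the disk of radius \<open>t / 8\<close>
around \<open>1\<close>. For \<open>w \<in> E\<close> and \<open>z\<close> in the disk of radius \<open>t / 8\<close> around \<open>1 - t\<close>, the
number \<open>1 - z * cnj w\<close> is within \<open>t / 4\<close> of \<open>t\<close>, so \<open>Re_T_kernel_ge\<close> applies.
\<close>

lemma boundary_potential_le_of_bounded:
  assumes \<nu>: "finite_measure \<nu>" "sets \<nu> = sets (restrict_space borel {0..1})"
    and p: "1 \<le> p" and bdd: "bounded_L1_weak_Lp p (T_op \<nu>)"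
  obtains C where "0 \<le> C" "\<And>t. t \<in> {0<..1} \<Longrightarrow> boundary_potential \<nu> t \<le> C * t powr (1 - 2 / p)"
proof -
  interpret A: finite_measure disk_area by (rule finite_measure_disk_area)
  obtain K where K: "0 \<le> K" and T: "\<And>f. integrable disk_area f \<Longrightarrow> T_op \<nu> f \<in> weak_Lp p"
      "\<And>f. integrable disk_area f \<Longrightarrow> weak_norm p (T_op \<nu> f) \<le> ennreal (K * (\<integral>z. cmod (f z) \<partial>disk_area))"
    using bdd unfolding bounded_L1_weak_Lp_def by blast
  show ?thesis
  proof
    show "0 \<le> 256 * (K + 1)" using K by simp
    fix t :: real assume t: "t \<in> {0<..1}"
    define G where "G = boundary_potential \<nu> t"
    have "0 \<le> G" unfolding G_def boundary_potential_def
      by (intro integral_nonneg_AE AE_I2) (use t in \<open>auto simp: space_unit_interval[OF \<nu>(2)]\<close>)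
    show "G \<le> 256 * (K + 1) * t powr (1 - 2 / p)"
    proof (cases "G = 0")
      case False
      with \<open>0 \<le> G\<close> have G: "0 < G" by simp
      define E where "E = ball 1 (t / 8) \<inter> ball (0::complex) 1"
      define m where "m = measure disk_area E"
      define f where "f = (\<lambda>w. indicator E w :: complex)"
      have E: "E \<in> sets disk_area" by (rule borel_in_sets_disk_area) (auto simp: E_def)
      have m: "0 < m"
      proof -
        have sub: "ball (of_real (1 - t / 16)) (t / 16) \<subseteq> E"
        proof
          fix w assume w: "w \<in> ball (complex_of_real (1 - t / 16)) (t / 16)"
          then have w': "cmod (of_real (1 - t / 16) - w) < t / 16" by (simp add: dist_norm)
          have "cmod w \<le> cmod (complex_of_real (1 - t / 16)) + cmod (of_real (1 - t / 16) - w)"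
            using norm_triangle_sub norm_minus_commute by metis
          also have "cmod (complex_of_real (1 - t / 16)) = 1 - t / 16"
            unfolding norm_of_real using t by simp
          finally have "cmod w < 1" using w' by linarith
          have "1 - w = of_real (t / 16) + (of_real (1 - t / 16) - w)" by simp
          then have "cmod (1 - w) \<le> cmod (complex_of_real (t / 16)) + cmod (of_real (1 - t / 16) - w)"
            using norm_triangle_ineq by metis
          also have "cmod (complex_of_real (t / 16)) = t / 16"
            unfolding norm_of_real using t by simp
          finally have "cmod (1 - w) < t / 8" using w' by linarith
          then show "w \<in> E" using \<open>cmod w < 1\<close> by (simp add: E_def dist_norm)
        qed
        then have "measure disk_area (ball (of_real (1 - t / 16)) (t / 16)) = (t / 16)\<^sup>2"
          using t by (intro measure_disk_area_ball) (auto simp: E_def)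
        moreover have "measure disk_area (ball (of_real (1 - t / 16)) (t / 16)) \<le> m"
          unfolding m_def by (rule A.finite_measure_mono[OF sub E])
        moreover have "0 < (t / 16)\<^sup>2" using t by simp
        ultimately show ?thesis by linarith
      qed
      have E1: "E \<inter> space disk_area = E" by (auto simp: E_def)
      have f_int: "integrable disk_area f"
        unfolding f_def using E
        by (intro A.integrable_const_bound[of _ 1] AE_I2) (auto simp: indicator_def[abs_def] intro!: borel_measurable_indicator)
      have f_norm: "(\<integral>z. cmod (f z) \<partial>disk_area) = m"
      proof -
        have "(\<lambda>z. cmod (f z)) = indicator E" by (auto simp: f_def indicator_def)
        then show ?thesis using E1 by (simp add: m_def)
      qed
      have lower: "2 / (5 * t) * G * m \<le> cmod (T_op \<nu> f z)" if z: "z \<in> ball (of_real (1 - t)) (t / 8)" "z \<in> ball 0 1" for z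
      proof -
        have ze: "cmod (z * cnj w) \<le> cmod z" if "w \<in> ball 0 1" for w
          using that mult_left_le[of "cmod w" "cmod z"] by (simp add: norm_mult)
        have meas: "(\<lambda>w. T_kernel \<nu> (z * cnj w) * f w) \<in> borel_measurable disk_area"
        proof -
          have "(\<lambda>w. z * cnj w) \<in> borel_measurable disk_area"
            by (rule measurable_disk_area_borel, intro borel_measurable_continuous_onI continuous_intros)
          from measurable_compose[OF this measurable_T_kernel[OF \<nu>]]
          show ?thesis using borel_measurable_integrable[OF f_int] by (rule borel_measurable_times)
        qed
        have int: "integrable disk_area (\<lambda>w. T_kernel \<nu> (z * cnj w) * f w)"
        proof (rule A.integrable_const_bound[OF _ meas], rule AE_I2)
          fix w assume "w \<in> space disk_area"
          then have "cmod (T_kernel \<nu> (z * cnj w)) \<le> (2 * measure \<nu> {0..1} + 1) / (1 - cmod z)\<^sup>2"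
            using z by (intro norm_T_kernel_le_crude[OF \<nu> ze]) auto
          then show "norm (T_kernel \<nu> (z * cnj w) * f w) \<le> (2 * measure \<nu> {0..1} + 1) / (1 - cmod z)\<^sup>2"
            by (auto simp: f_def norm_mult indicator_def intro!: divide_nonneg_nonneg add_nonneg_nonneg)
        qed
        have "2 / (5 * t) * G * m = (\<integral>w. 2 / (5 * t) * G * indicator E w \<partial>disk_area)"
          using E1 by (simp add: m_def)
        also have "\<dots> \<le> (\<integral>w. Re (T_kernel \<nu> (z * cnj w) * f w) \<partial>disk_area)"
        proof (rule integral_mono)
          show "integrable disk_area (\<lambda>w. 2 / (5 * t) * G * indicator E w)"
            using E A.emeasure_finite by (intro integrable_mult_right) (simp add: less_top[symmetric])
          show "integrable disk_area (\<lambda>w. Re (T_kernel \<nu> (z * cnj w) * f w))"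
            using int by (rule integrable_Re)
          fix w assume w: "w \<in> space disk_area"
          show "2 / (5 * t) * G * indicator E w \<le> Re (T_kernel \<nu> (z * cnj w) * f w)"
          proof (cases "w \<in> E")
            case True
            have "1 - z * cnj w - of_real t = (of_real (1 - t) - z) + z * cnj (1 - w)"
              by (simp add: algebra_simps)
            then have "cmod (1 - z * cnj w - of_real t) \<le> cmod (of_real (1 - t) - z) + cmod (z * cnj (1 - w))"
              using norm_triangle_ineq by metis
            also have "cmod (z * cnj (1 - w)) \<le> cmod (1 - w)"
              using z mult_left_le_one_le[of "cmod (1 - w)" "cmod z"] unfolding norm_mult complex_mod_cnj by simp
            also have "cmod (of_real (1 - t) - z) + cmod (1 - w) \<le> t / 8 + t / 8"
              using z True by (intro add_mono) (auto simp: E_def dist_norm)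
            finally have "cmod (1 - z * cnj w - of_real t) \<le> t / 4" by simp
            moreover have "cmod (z * cnj w) < 1" using ze[of w] w z by auto
            ultimately have "2 / (5 * t) * G \<le> Re (T_kernel \<nu> (z * cnj w))"
              unfolding G_def using t by (intro Re_T_kernel_ge[OF \<nu>]) auto
            then show ?thesis using True by (simp add: f_def)
          qed (simp add: f_def)
        qed
        also have "\<dots> = Re (T_op \<nu> f z)" unfolding T_op_eq by (rule integral_Re[OF int])
        also have "\<dots> \<le> cmod (T_op \<nu> f z)" by (rule complex_Re_le_cmod)
        finally show ?thesis .
      qed
      \<comment> \<open>The level \<open>s\<close> is strictly below the lower bound \<open>2 / (5 * t) * G * m\<close>.\<close>
      define s where "s = m * G / (4 * t)"
      have s: "0 < s" using m G t by (simp add: s_def)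
      \<comment> \<open>Passing to \<open>K + 1\<close> makes the inequality for the infimum strict.\<close>
      have "weak_norm p (T_op \<nu> f) \<le> ennreal (K * m)" using T(2)[OF f_int] by (simp add: f_norm)
      also have "\<dots> < ennreal ((K + 1) * m)" using K m by (subst ennreal_less_iff) (auto simp: algebra_simps)
      finally have weak: "measure disk_area {z \<in> ball 0 1. s < cmod (T_op \<nu> f z)} \<le> ((K + 1) * m) powr p / s powr p"
        using s p by (intro weak_norm_less_imp) auto
      have ball_sub: "ball (of_real (1 - t)) (t / 8) \<subseteq> ball (0::complex) 1"
      proof
        fix z assume z: "z \<in> ball (complex_of_real (1 - t)) (t / 8)"
        have "cmod z \<le> cmod (complex_of_real (1 - t)) + cmod (of_real (1 - t) - z)"
          using norm_triangle_sub norm_minus_commute by metis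
        also have "cmod (complex_of_real (1 - t)) = 1 - t" unfolding norm_of_real using t by simp
        also have "cmod (of_real (1 - t) - z) < t / 8" using z by (simp add: dist_norm)
        finally show "z \<in> ball 0 1" using t by simp
      qed
      have "t\<^sup>2 / 64 = (t / 8)\<^sup>2" by (simp add: power_divide)
      also have "\<dots> = measure disk_area (ball (of_real (1 - t)) (t / 8))"
        using t by (intro measure_disk_area_ball[symmetric] ball_sub) auto
      also have "\<dots> \<le> measure disk_area {z \<in> ball 0 1. s < cmod (T_op \<nu> f z)}"
      proof (rule A.finite_measure_mono)
        have "T_op \<nu> f \<in> borel_measurable disk_area" using T(1)[OF f_int] by (simp add: weak_Lp_def)
        then have "{z \<in> space disk_area. s < cmod (T_op \<nu> f z)} \<in> sets disk_area" by measurable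
        then show "{z \<in> ball 0 1. s < cmod (T_op \<nu> f z)} \<in> sets disk_area" by simp
        have "s < 2 / (5 * t) * G * m" using m G t by (simp add: s_def field_simps)
        then show "ball (of_real (1 - t)) (t / 8) \<subseteq> {z \<in> ball 0 1. s < cmod (T_op \<nu> f z)}"
          using lower ball_sub by (force intro: less_le_trans)
      qed
      also note weak
      also have "((K + 1) * m) powr p / s powr p = (4 * (K + 1) * t / G) powr p"
      proof -
        have "(K + 1) * m / s = 4 * (K + 1) * t / G" using m G t by (simp add: s_def field_simps)
        then show ?thesis by (simp only: powr_divide[symmetric])
      qed
      finally have main: "t\<^sup>2 / 64 \<le> (4 * (K + 1) * t / G) powr p" .
      have "(t\<^sup>2 / 64) powr (1 / p) \<le> ((4 * (K + 1) * t / G) powr p) powr (1 / p)"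
        using main p by (intro powr_mono2) auto
      also have "\<dots> = 4 * (K + 1) * t / G" using p K t G by (simp add: powr_powr)
      finally have 1: "G * (t\<^sup>2 / 64) powr (1 / p) \<le> 4 * (K + 1) * t" using G by (simp add: field_simps)
      have 2: "(t\<^sup>2 / 64) powr (1 / p) = t powr (2 / p) / 64 powr (1 / p)"
        using t by (simp add: powr_divide powr_powr flip: powr_numeral)
      have 3: "64 powr (1 / p) \<le> (64::real)" using p powr_mono[of "1 / p" 1 "64::real"] by simp
      have "G = G * (t\<^sup>2 / 64) powr (1 / p) * (64 powr (1 / p) / t powr (2 / p))"
        using t unfolding 2 by simp
      also have "\<dots> \<le> 4 * (K + 1) * t * (64 / t powr (2 / p))"
        by (rule mult_mono[OF 1 divide_right_mono[OF 3]]) (use K t in auto)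
      also have "\<dots> = 256 * (K + 1) * t powr (1 - 2 / p)" using t by (simp add: powr_diff)
      finally show ?thesis .
    qed (use K in simp)
  qed
qed

lemma Carleson_if_bounded:
  assumes \<nu>: "finite_measure \<nu>" "sets \<nu> = sets (restrict_space borel {0..1})"
    and p: "1 \<le> p" and bdd: "bounded_L1_weak_Lp p (T_op \<nu>)"
  shows "Carleson_condition (2 * (1 - 1 / p)) \<nu>"
proof -
  interpret finite_measure \<nu> by (rule \<nu>)
  obtain C where C: "0 \<le> C" "\<And>t. t \<in> {0<..1} \<Longrightarrow> boundary_potential \<nu> t \<le> C * t powr (1 - 2 / p)"
    using boundary_potential_le_of_bounded[OF \<nu> p bdd] by blast
  have "measure \<nu> {1 - t..<1} \<le> 9 / 4 * C * t powr (2 * (1 - 1 / p))" if t: "t \<in> {0<..1}" for t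
  proof -
    have S: "{1 - t..<1} \<in> sets \<nu>" by (rule sets_unit_interval[OF \<nu>(2)]) (use t in auto)
    have "1 / (9 / 4 * t) * measure \<nu> {1 - t..<1} = (\<integral>r. 1 / (9 / 4 * t) * indicator {1 - t..<1} r \<partial>\<nu>)"
      using sets.sets_into_space[OF S] by (simp add: Int_absorb2)
    also have "\<dots> \<le> boundary_potential \<nu> t"
      unfolding boundary_potential_def
    proof (rule integral_mono')
      show "integrable \<nu> (\<lambda>r. 1 / ((1 - r) + 5 * t / 4))" using t by (intro integrable_boundary_potential[OF \<nu>]) auto
      show "1 / (9 / 4 * t) * indicator {1 - t..<1} r \<le> 1 / ((1 - r) + 5 * t / 4)" if "r \<in> space \<nu>" for r
      proof (cases "r \<in> {1 - t..<1}")
        case True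
        then have "1 / (9 / 4 * t) \<le> 1 / ((1 - r) + 5 * t / 4)"
          using t by (intro divide_left_mono mult_pos_pos) auto
        then show ?thesis using True by simp
      qed (use that t in \<open>auto simp: space_unit_interval[OF \<nu>(2)]\<close>)
      show "0 \<le> 1 / ((1 - r) + 5 * t / 4)" if "r \<in> space \<nu>" for r
        using that t by (auto simp: space_unit_interval[OF \<nu>(2)])
    qed
    also have "\<dots> \<le> C * t powr (1 - 2 / p)" by (rule C(2)[OF t])
    finally have "measure \<nu> {1 - t..<1} \<le> 9 / 4 * C * (t * t powr (1 - 2 / p))"
      using t by (simp add: field_simps)
    also have "t * t powr (1 - 2 / p) = t powr (2 * (1 - 1 / p))"
    proof -
      have "t * t powr (1 - 2 / p) = t powr (1 + (1 - 2 / p))" using t by (simp only: powr_add) simp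
      then show ?thesis by (simp add: algebra_simps)
    qed
    finally show ?thesis .
  qed
  then show ?thesis unfolding Carleson_condition_iff[OF \<nu>(1)] by blast
qed

lemma hyperbolic_integrable_if_bounded:
  assumes \<nu>: "finite_measure \<nu>" "sets \<nu> = sets (restrict_space borel {0..1})"
    and bdd: "bounded_L1_weak_Lp 2 (T_op \<nu>)"
  shows "hyperbolic_integrable \<nu>"
proof -
  obtain C where C: "0 \<le> C" "\<And>t. t \<in> {0<..1} \<Longrightarrow> boundary_potential \<nu> t \<le> C * t powr (1 - 2 / 2)"
    using boundary_potential_le_of_bounded[OF \<nu> _ bdd] by auto
  define t where "t = (\<lambda>n::nat. 1 / real (Suc n))"
  have t: "t n \<in> {0<..1}" for n by (auto simp: t_def)
  define g where "g = (\<lambda>n r. ennreal (1 / ((1 - r) + 5 * t n / 4)))"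
  have g_meas: "g n \<in> borel_measurable \<nu>" for n
    unfolding g_def by (rule measurable_unit_interval_borel[OF \<nu>(2)]) measurable
  have g_int: "(\<integral>\<^sup>+r. g n r \<partial>\<nu>) \<le> ennreal C" for n
  proof -
    have "(\<integral>\<^sup>+r. g n r \<partial>\<nu>) = ennreal (boundary_potential \<nu> (t n))"
      unfolding g_def boundary_potential_def using t[of n]
      by (intro nn_integral_eq_integral integrable_boundary_potential[OF \<nu>] AE_I2)
         (auto simp: space_unit_interval[OF \<nu>(2)])
    also have "\<dots> \<le> ennreal C" using C(2)[OF t[of n]] t[of n] by (intro ennreal_leI) simp
    finally show ?thesis .
  qed
  have lim: "(\<lambda>n. g n r) \<longlonglongrightarrow> ennreal (1 / (1 - r))" if "r < 1" for r
  proof -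
    have "(\<lambda>n. 1 / ((1 - r) + 5 * t n / 4)) \<longlonglongrightarrow> 1 / ((1 - r) + 5 * 0 / 4)"
      unfolding t_def using that by (intro tendsto_intros LIMSEQ_Suc[OF lim_1_over_n]) auto
    then show ?thesis unfolding g_def by (intro tendsto_ennrealI) simp
  qed
  have "(\<integral>\<^sup>+ r\<in>{0..<1}. ennreal (1 / (1 - r\<^sup>2)) \<partial>\<nu>) \<le> (\<integral>\<^sup>+r. liminf (\<lambda>n. g n r) \<partial>\<nu>)"
  proof (rule nn_integral_mono)
    fix r assume "r \<in> space \<nu>"
    show "ennreal (1 / (1 - r\<^sup>2)) * indicator {0..<1} r \<le> liminf (\<lambda>n. g n r)"
    proof (cases "r \<in> {0..<1}")
      case True
      then have "1 - r \<le> 1 - r\<^sup>2" by (simp add: power2_eq_square mult_left_le)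
      then have "1 / (1 - r\<^sup>2) \<le> 1 / (1 - r)"
        using True by (intro divide_left_mono mult_pos_pos) auto
      moreover have "liminf (\<lambda>n. g n r) = ennreal (1 / (1 - r))"
        using lim[of r] True by (intro lim_imp_Liminf) auto
      ultimately show ?thesis using True by (simp add: ennreal_leI)
    qed simp
  qed
  also have "\<dots> \<le> liminf (\<lambda>n. \<integral>\<^sup>+r. g n r \<partial>\<nu>)" by (rule nn_integral_liminf[OF g_meas])
  also have "\<dots> \<le> ennreal C" by (rule Liminf_le) (auto intro!: always_eventually g_int)
  finally show ?thesis unfolding hyperbolic_integrable_def by (auto intro: le_less_trans)
qed

section \<open>Characterization of boundedness\<close>

theorem theorem6p2:
  fixes \<nu> :: "real measure"
  assumes "finite_measure \<nu>"
    and "sets \<nu> = sets (restrict_space borel {0..1})"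
  shows "(1 \<le> critical_index \<nu> \<and> critical_index \<nu> < 2 \<longrightarrow>
            (bounded_L1_weak_Lp (critical_index \<nu>) (T_op \<nu>) \<longleftrightarrow>
             Carleson_condition (two_over_dual (critical_index \<nu>)) \<nu>)) \<and>
         (critical_index \<nu> = 2 \<longrightarrow>
            (bounded_L1_weak_Lp 2 (T_op \<nu>) \<longleftrightarrow> hyperbolic_integrable \<nu>))"
proof (intro conjI impI iffI)
  let ?c = "critical_index \<nu>"
  assume c: "1 \<le> ?c \<and> ?c < 2"
  show "Carleson_condition (two_over_dual ?c) \<nu>" if "bounded_L1_weak_Lp ?c (T_op \<nu>)"
    using Carleson_if_bounded[OF assms _ that] c by (simp add: two_over_dual_eq)
  show "bounded_L1_weak_Lp ?c (T_op \<nu>)" if "Carleson_condition (two_over_dual ?c) \<nu>"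
  proof (cases "?c = 1")
    case True
    show ?thesis
      unfolding True
    proof (rule bounded_if_kernel_bound[OF assms])
      show "0 < 2 * measure \<nu> {0..1} + 1" by (simp add: add_nonneg_pos)
    qed (use T_kernel_bound_general[OF assms] in auto)
  next
    case False
    then have "1 < ?c" using c by simp
    moreover have "Carleson_condition (2 * (1 - 1 / ?c)) \<nu>" using that c by (simp add: two_over_dual_eq)
    ultimately obtain B where "0 < B" "\<And>\<zeta>. cmod \<zeta> < 1 \<Longrightarrow> cmod (T_kernel \<nu> \<zeta>) \<le> B / cmod (1 - \<zeta>) powr (2 / ?c)"
      using T_kernel_bound_Carleson[OF assms no_atom_at_1[OF assms]] c by blast
    then show ?thesis using c by (intro bounded_if_kernel_bound[OF assms]) auto
  qed
next
  assume c: "critical_index \<nu> = 2"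
  show "hyperbolic_integrable \<nu>" if "bounded_L1_weak_Lp 2 (T_op \<nu>)"
    using assms that by (rule hyperbolic_integrable_if_bounded)
  assume "hyperbolic_integrable \<nu>"
  then obtain B where "0 < B" "\<And>\<zeta>. cmod \<zeta> < 1 \<Longrightarrow> cmod (T_kernel \<nu> \<zeta>) \<le> B / cmod (1 - \<zeta>) powr (2 / 2)"
    using T_kernel_bound_hyperbolic[OF assms no_atom_at_1[OF assms]] c by auto
  then show "bounded_L1_weak_Lp 2 (T_op \<nu>)" by (intro bounded_if_kernel_bound[OF assms]) auto
qed

end
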